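(* Let $\alpha=0$, $c\ge1$, $R>0$, and suppose the ACGD-S method (described in the context) is run with outer-loop stepsizes, for $t\ge1$, $$\tau_t=\tfrac{t-1}2,\quad\eta_t=\frac{L(\Lambda_c)}{\tau_{t+1}},\quad\omega_t=t,\quad\theta_{t+1}=\omega_t/\omega_{t+1},$$ and inner-loop parameters in phase $t$ given, with $M_t=\|\nu^t\|$ if $\|\nu^t\|>0$ and $M_t=1$ otherwise, by $$\Delta=\frac{R}{L(\Lambda_c)},\quad S_t=\lceil M_t\Delta t\rceil,\quad\tilde M_t=\frac{S_t}{\Delta t},$$ $$\rho^{(t)}_s=\begin{cases}\tilde M_t/\tilde M_{t-1}&s=1,\ t\ge2,\\1&s\ge2\text{ or }(s,t)=(1,1),\end{cases}\qquad\beta^{(t)}_s=\tilde M_tR,\quad\gamma^{(t)}_s=\tilde M_t/R,\quad\delta^{(t)}_s=1\quad\forall s\ge1.$$ Then $M_t\le\bar M$ for all $t$, where $\bar M$ is an upper bound of $\max\{1,\|\nabla g(x)\|\}$ over all $x$ in some bounded neighborhood of $x^*$. Moreover, with $d(\Lambda_c):=\|\lambda^*\|+c$, the ergodic average $\bar x^N=\sum_{t=1}^N\omega_tx^t/\sum_{t=1}^N\omega_t$ satisfies $$\max\{F(\bar x^N)-F_*,\ c\|[g(\bar x^N)]_+\|\}\le\frac{L(\Lambda_c)}{N(N+1)}\Big(3\|x^0-x^*\|^2+\frac{d(\Lambda_c)^2}{R^2}\Big).$$ Consequently, for $\epsilon>0$, an $(\epsilon;\epsilon/c)$-optimal solution is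 obtained with at most $N_\epsilon$ gradient-oracle evaluations and $C_\epsilon$ matrix-vector multiplications, where $$N_\epsilon=\sqrt{\frac{L(\Lambda_c)}{\epsilon}}\sqrt{3\|x^0-x^*\|^2+\frac{d(\Lambda_c)^2}{R^2}}+1,$$ $$C_\epsilon=O\Big\{N_\epsilon+\frac{\bar MR}{L(\Lambda_c)}+\frac{\bar M}{\epsilon}\Big(\|x^0-x^*\|^2R+\frac{d(\Lambda_c)^2}{R}\Big)\Big\},$$ with an absolute constant in $O\{\cdot\}$.
   Context: Problem: $\min_{x\in X}\{F(x):=f(x)+u(x)\}$ subject to $g(x)\le 0$, where $X\subseteq\mathbb R^n$ is closed and convex, $f:\mathbb R^n\to\mathbb R$ and $g=(g_1,\dots,g_m):\mathbb R^n\to\mathbb R^m$ are convex (componentwise) and differentiable with Lipschitz continuous gradients, and $u$ is a convex, $\alpha$-strongly convex function, $\alpha\ge0$ (here $\alpha=0$). Norms are Euclidean (operator norm for matrices), $[\cdot]_+$ is the componentwise positive part, $\nabla g(x)$ is the $m\times n$ Jacobian. There is a KKT pair: $x^*\in X$ optimal, $\lambda^*\in\mathbb R^m_+$ with $-[\nabla f(x^* )+\sum_i\lambda_i^*\nabla g_i(x^* )+u']\in N_X(x^* )$ for some $u'\in\partial u(x^* )$, $g(x^* )\le0$, $\lambda^*_ig_i(x^* )=0$ for all $i$; $F_*=F(x^* )$. A point $x$ is $(\epsilon;\epsilon/c)$-optimal if $F(x)-F_*\le\epsilon$ and $\|[g(x)]_+\|\le\epsilon/c$. For $\lambda\in\mathbb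 R^m_+$, $L_\lambda$ is a Lipschitz constant on $\mathbb R^n$ of the gradient of $f+\sum_i\lambda_ig_i$; $L(\Lambda)=\sup_{\lambda\in\Lambda}L_\lambda$; $\Lambda_r=\{0\}\cup\{\lambda^*+\lambda:\lambda\in\mathbb R^m_+,\|\lambda\|\le r\}$. Complexity bounds concern the nontrivial regime in which $x^0$ does not already satisfy the termination criterion. ACGD-S method: $x^{-1}=\underline x^0=y^{(1)}_0=x^0\in X$, $\pi^0=\nabla f(x^0)$, $\nu^0=\nabla g(x^0)$, $\lambda^{(1)}_{-1}=\lambda^{(1)}_0=0$. For phases $t=1,\dots,N$: 1. $\tilde x^t=x^{t-1}+\theta_t(x^{t-1}-x^{t-2})$, $\underline x^t=(\tau_t\underline x^{t-1}+\tilde x^t)/(1+\tau_t)$, $\pi^t=\nabla f(\underline x^t)$, $\nu^t=\nabla g(\underline x^t)$; compute $S_t$ and the inner parameters. ($\theta_1$ is immaterial because $x^0=x^{-1}$.) 2. For $s=1,\dots,S_t$: $\tilde h^{(t),s}=(\nu^t)^\top\lambda^{(t)}_0+\rho^{(t)}_1(\nu^{t-1})^\top(\lambda^{(t)}_0-\lambda^{(t)}_{-1})$ if $s=1$, and $\tilde h^{(t),s}=(\nu^t)^\top\lambda^{(t)}_{s-1}+\rho^{(t)}_s(\nu^t)^\top(\lambda^{(t)}_{s-1}-\lambda^{(t)}_{s-2})$ otherwise; $y^{(t)}_s=\operatorname{argmin}_{y\in X}\langle\tilde h^{(t),s}+\pi^t,y\rangle+u(y)+\frac{\eta_t}2\|y-x^{t-1}\|^2+\frac{\beta^{(t)}_s}2\|y-y^{(t)}_{s-1}\|^2$;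 $\lambda^{(t)}_s=\operatorname{argmax}_{\lambda\in\mathbb R^m_+}\langle\lambda,\nu^t(y^{(t)}_s-\underline x^t)+g(\underline x^t)\rangle-\frac{\gamma^{(t)}_s}2\|\lambda-\lambda^{(t)}_{s-1}\|^2$. 3. $\lambda^{(t+1)}_0=\lambda^{(t)}_{S_t}$, $\lambda^{(t+1)}_{-1}=\lambda^{(t)}_{S_t-1}$, $y^{(t+1)}_0=y^{(t)}_{S_t}$; $x^t=\sum_s\delta^{(t)}_sy^{(t)}_s/\sum_s\delta^{(t)}_s$, $\tilde\lambda^t=\sum_s\delta^{(t)}_s\lambda^{(t)}_s/\sum_s\delta^{(t)}_s$. One gradient-oracle evaluation of $(f,g)$ is made per phase, and each inner iteration uses fewer than three matrix-vector multiplications. *)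

theory Defs
  imports "HOL-Analysis.Analysis"
begin

text \<open>Vectors of multipliers and constraint values use the componentwise order of
  \<^typ>\<open>real ^ 'm\<close>, so \<open>0 \<le> l\<close> means that \<open>l\<close> lies in the nonnegative orthant.\<close>

definition normal_cone :: "'a::real_inner set \<Rightarrow> 'a \<Rightarrow> 'a set" where
  "normal_cone X x = {v. \<forall>y\<in>X. v \<bullet> (y - x) \<le> 0}"

text \<open>The set \<open>D\<close> is the effective domain of \<open>u\<close>: this is the subdifferential of the
  function that agrees with \<open>u\<close> on \<open>D\<close> and is \<open>+\<infinity>\<close> elsewhere.\<close>

definition subdifferential :: "'a::real_inner set \<Rightarrow> ('a \<Rightarrow> real) \<Rightarrow> 'a \<Rightarrow> 'a set" where
  "subdifferential D u x = {v. \<forall>y\<in>D. u x + v \<bullet> (y - x) \<le> u y}"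

definition pos_part :: "real ^ 'm \<Rightarrow> real ^ 'm" where
  "pos_part v = (\<chi> i. max (v $ i) 0)"

definition op_norm :: "real ^ 'n ^ 'm \<Rightarrow> real" where
  "op_norm A = onorm ((*v) A)"

text \<open>\<open>gradf\<close> and \<open>J\<close> stand for the gradient of \<open>f\<close> and the Jacobian of \<open>g\<close>; row \<open>i\<close> of
  the Jacobian is the gradient of \<open>g\<^sub>i\<close>.\<close>

definition lagrangian_grad ::
  "(real ^ 'n \<Rightarrow> real ^ 'n) \<Rightarrow> (real ^ 'n \<Rightarrow> real ^ 'n ^ 'm) \<Rightarrow> real ^ 'm \<Rightarrow> real ^ 'n \<Rightarrow> real ^ 'n" where
  "lagrangian_grad gradf J l x = gradf x + (\<Sum>i\<in>UNIV. l $ i *\<^sub>R J x $ i)"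

definition smooth_convex_problem ::
  "(real ^ 'n) set \<Rightarrow> (real ^ 'n \<Rightarrow> real) \<Rightarrow> (real ^ 'n \<Rightarrow> real ^ 'n) \<Rightarrow>
   (real ^ 'n \<Rightarrow> real ^ 'm) \<Rightarrow> (real ^ 'n \<Rightarrow> real ^ 'n ^ 'm) \<Rightarrow>
   (real ^ 'n) set \<Rightarrow> (real ^ 'n \<Rightarrow> real) \<Rightarrow> bool" where
  "smooth_convex_problem X f gradf g J D u \<longleftrightarrow>
     closed X \<and> convex X \<and>
     convex_on UNIV f \<and> (\<forall>x. GDERIV f x :> gradf x) \<and>
     (\<exists>K. K-lipschitz_on UNIV gradf) \<and>
     (\<forall>i. convex_on UNIV (\<lambda>x. g x $ i)) \<and> (\<forall>x. (g has_derivative (*v) (J x)) (at x)) \<and>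
     (\<forall>i. \<exists>K. K-lipschitz_on UNIV (\<lambda>x. J x $ i)) \<and>
     X \<subseteq> D \<and> convex_on D u"

definition kkt_pair ::
  "(real ^ 'n) set \<Rightarrow> (real ^ 'n \<Rightarrow> real) \<Rightarrow> (real ^ 'n \<Rightarrow> real ^ 'n) \<Rightarrow>
   (real ^ 'n \<Rightarrow> real ^ 'm) \<Rightarrow> (real ^ 'n \<Rightarrow> real ^ 'n ^ 'm) \<Rightarrow>
   (real ^ 'n) set \<Rightarrow> (real ^ 'n \<Rightarrow> real) \<Rightarrow> real ^ 'n \<Rightarrow> real ^ 'm \<Rightarrow> bool" where
  "kkt_pair X f gradf g J D u xs ls \<longleftrightarrow>
     is_arg_min (\<lambda>x. f x + u x) (\<lambda>x. x \<in> X \<and> g x \<le> 0) xs \<and>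
     0 \<le> ls \<and>
     (\<exists>u'\<in>subdifferential D u xs. - (lagrangian_grad gradf J ls xs + u') \<in> normal_cone X xs) \<and>
     (\<forall>i. ls $ i * g xs $ i = 0)"

definition eps_optimal ::
  "(real ^ 'n) set \<Rightarrow> (real ^ 'n \<Rightarrow> real) \<Rightarrow> (real ^ 'n \<Rightarrow> real ^ 'm) \<Rightarrow> real \<Rightarrow>
   real \<Rightarrow> real \<Rightarrow> real ^ 'n \<Rightarrow> bool" where
  "eps_optimal X F g Fs e1 e2 x \<longleftrightarrow> x \<in> X \<and> F x - Fs \<le> e1 \<and> norm (pos_part (g x)) \<le> e2"

definition multiplier_set :: "real ^ 'm \<Rightarrow> real \<Rightarrow> (real ^ 'm) set" where
  "multiplier_set ls r = {0} \<union> {ls + l | l. 0 \<le> l \<and> norm l \<le> r}"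

text \<open>One infinite run of the ACGD-S method (its stepsizes do not depend on the number of phases).
  Phase indices start at 1, index 0 holding the initial data. The iterates \<open>x\<close> and the inner
  multipliers \<open>lam t\<close> carry integer indices because the method uses \<open>x (-1)\<close> and \<open>lam t (-1)\<close>.
  The points \<open>xt\<close>, \<open>xu\<close> are the extrapolated and the averaged (underlined) points, \<open>p\<close> and \<open>nu\<close>
  the gradients \<open>\<pi>\<close> and Jacobians \<open>\<nu>\<close> there. The numbers \<open>S t\<close> and the inner
  parameters are arbitrary sequences here, and may depend on \<open>nu\<close>.\<close>

definition acgd_s_run ::
  "(real ^ 'n) set \<Rightarrow> (real ^ 'n \<Rightarrow> real ^ 'n) \<Rightarrow> (real ^ 'n \<Rightarrow> real ^ 'm) \<Rightarrow>
   (real ^ 'n \<Rightarrow> real ^ 'n ^ 'm) \<Rightarrow> (real ^ 'n \<Rightarrow> real) \<Rightarrow>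
   (nat \<Rightarrow> real) \<Rightarrow> (nat \<Rightarrow> real) \<Rightarrow> (nat \<Rightarrow> real) \<Rightarrow>
   (nat \<Rightarrow> nat) \<Rightarrow> (nat \<Rightarrow> nat \<Rightarrow> real) \<Rightarrow> (nat \<Rightarrow> nat \<Rightarrow> real) \<Rightarrow>
   (nat \<Rightarrow> nat \<Rightarrow> real) \<Rightarrow> (nat \<Rightarrow> nat \<Rightarrow> real) \<Rightarrow>
   real ^ 'n \<Rightarrow> (int \<Rightarrow> real ^ 'n) \<Rightarrow> (nat \<Rightarrow> real ^ 'n) \<Rightarrow> (nat \<Rightarrow> real ^ 'n) \<Rightarrow>
   (nat \<Rightarrow> real ^ 'n) \<Rightarrow> (nat \<Rightarrow> real ^ 'n ^ 'm) \<Rightarrow> (nat \<Rightarrow> nat \<Rightarrow> real ^ 'n) \<Rightarrow>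
   (nat \<Rightarrow> nat \<Rightarrow> real ^ 'n) \<Rightarrow> (nat \<Rightarrow> int \<Rightarrow> real ^ 'm) \<Rightarrow> bool" where
  "acgd_s_run X gradf g J u \<tau> \<eta> \<theta> S \<rho> \<beta> \<gamma> \<delta> x0 x xt xu p nu h y lam \<longleftrightarrow>
     x0 \<in> X \<and> x (- 1) = x0 \<and> x 0 = x0 \<and> xu 0 = x0 \<and> y 1 0 = x0 \<and>
     p 0 = gradf x0 \<and> nu 0 = J x0 \<and> lam 1 (- 1) = 0 \<and> lam 1 0 = 0 \<and>
     (\<forall>t\<ge>1.
        xt t = x (int t - 1) + \<theta> t *\<^sub>R (x (int t - 1) - x (int t - 2)) \<and>
        xu t = (1 / (1 + \<tau> t)) *\<^sub>R (\<tau> t *\<^sub>R xu (t - 1) + xt t) \<and>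
        p t = gradf (xu t) \<and> nu t = J (xu t) \<and>
        (\<forall>s\<in>{1..S t}.
           h t s =
             (if s = 1
              then transpose (nu t) *v lam t 0
                   + \<rho> t 1 *\<^sub>R (transpose (nu (t - 1)) *v (lam t 0 - lam t (- 1)))
              else transpose (nu t) *v lam t (int s - 1)
                   + \<rho> t s *\<^sub>R (transpose (nu t) *v (lam t (int s - 1) - lam t (int s - 2)))) \<and>
           is_arg_min
             (\<lambda>z. (h t s + p t) \<bullet> z + u z + \<eta> t / 2 * (norm (z - x (int t - 1)))\<^sup>2
                  + \<beta> t s / 2 * (norm (z - y t (s - 1)))\<^sup>2)
             (\<lambda>z. z \<in> X) (y t s) \<and>
           is_arg_max
             (\<lambda>l. l \<bullet> (nu t *v (y t s - xu t) + g (xu t))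
                  - \<gamma> t s / 2 * (norm (l - lam t (int s - 1)))\<^sup>2)
             (\<lambda>l. 0 \<le> l) (lam t (int s))) \<and>
        lam (t + 1) 0 = lam t (int (S t)) \<and>
        lam (t + 1) (- 1) = lam t (int (S t) - 1) \<and>
        y (t + 1) 0 = y t (S t) \<and>
        x (int t) = (1 / (\<Sum>s=1..S t. \<delta> t s)) *\<^sub>R (\<Sum>s=1..S t. \<delta> t s *\<^sub>R y t s))"

definition ergodic_avg :: "(nat \<Rightarrow> real) \<Rightarrow> (int \<Rightarrow> real ^ 'n) \<Rightarrow> nat \<Rightarrow> real ^ 'n" where
  "ergodic_avg \<omega> x N = (1 / (\<Sum>t=1..N. \<omega> t)) *\<^sub>R (\<Sum>t=1..N. \<omega> t *\<^sub>R x (int t))"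

end

theory Submission
  imports Defs
begin

text \<open>Write \<open>L\<close> for \<open>L(\<Lambda>\<^sub>c)\<close>, \<open>x\<^sup>*\<close> and \<open>\<lambda>\<^sup>*\<close> for the KKT pair and \<open>z\<close> for the ergodic average of \<open>N\<close>
  phases. Everything follows from one bound on the gap of the Lagrangian, valid for every
  multiplier \<open>\<lambda>\<close> in \<open>\<Lambda>\<^sub>c\<close> (\<open>ergodic_bound\<close>):

  \<open>N (N + 1) / 2 * (F z + \<lambda> \<bullet> g z - F x\<^sup>*) + L * |x\<^sup>N - x\<^sup>*|\<^sup>2 \<le> L / 2 * (3 |x\<^sup>0 - x\<^sup>*|\<^sup>2 + |\<lambda>|\<^sup>2 / R\<^sup>2)\<close>.

  Three choices of \<open>\<lambda>\<close> exploit it. The choice \<open>\<lambda> = 0\<close> bounds the objective gap. Adding to \<open>\<lambda>\<^sup>*\<close> the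
  vector of length \<open>c\<close> in the direction of the constraint violation at \<open>z\<close> bounds that violation,
  because the Lagrangian at \<open>\<lambda>\<^sup>*\<close> is nowhere on \<open>X\<close> below \<open>F x\<^sup>*\<close>. For \<open>\<lambda> = \<lambda>\<^sup>*\<close> the first summand is
  therefore nonnegative, so the second one confines all \<open>x\<^sup>t\<close>, and with them the points at which
  Jacobians are evaluated, to a ball that does not depend on the number of phases.

  The gap bound combines two estimates, one for the outer and one for the inner loop.

  \<^item> The function \<open>f + \<lambda> \<bullet> g\<close> is \<open>L\<close>-smooth and convex. Linearizing it at \<open>z\<close>, where the linearization
    has the right value, instead of at the point \<open>xu t\<close> that phase \<open>t\<close> really uses costs at most
    \<open>L * (\<Sum>t. |x\<^sup>t - x\<^sup>t\<^sup>-\<^sup>1|\<^sup>2)\<close> in the sum with weights \<open>t\<close> (\<open>accelerated_linearization_bound\<close>). This is the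
    accelerated gradient argument: the Bregman distances between consecutive points \<open>xu t\<close>
    dominate squared gradient differences, and these absorb the cross terms left by the momentum.

  \<^item> With the linearizations at \<open>xu t\<close>, phase \<open>t\<close> is a primal-dual method for a bilinear saddle-point
    problem. Each inner step lowers a potential by at least the weighted gap at the new point plus
    the change of the terms centred at \<open>x\<^sup>t\<^sup>-\<^sup>1\<close> (\<open>primal_dual_step\<close>). The proximal term centred at \<open>x\<^sup>t\<^sup>-\<^sup>1\<close> contributes, after averaging over the
    phase, exactly the \<open>L * |x\<^sup>t - x\<^sup>t\<^sup>-\<^sup>1|\<^sup>2\<close> that the outer loop costs (\<open>phase_bound\<close>).

  The potentials of different phases fit together although the Jacobian changes. An inner step of
  phase \<open>t\<close> carries the weight \<open>t / S t\<close>, which equals \<open>L / (R * Mt t)\<close>; this turns the proximal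
  coefficients into \<open>L\<close> and \<open>L / R\<^sup>2\<close> in every phase, and \<open>\<rho>\<close> turns the weight of the new phase
  into that of the old one in front of the extrapolation term. Rounding \<open>S t\<close> up makes \<open>Mt t\<close> at least
  the norm of the Jacobian, so the bilinear term in the potential is dominated by its squares.

  The operation counts follow by taking the least \<open>N\<close> with \<open>N\<^sup>2 \<ge> L P / \<epsilon>\<close>, where
  \<open>P = 3 |x\<^sup>0 - x\<^sup>*|\<^sup>2 + d\<^sup>2 / R\<^sup>2\<close>, and summing \<open>S t \<le> M t * \<Delta> * t + 1\<close>.\<close>

section \<open>Smooth convex functions\<close>

lemma convex_gradient_inequality:
  fixes h :: "'a::real_inner \<Rightarrow> real"
  assumes "convex_on UNIV h" and "GDERIV h a :> G"
  shows "h a + G \<bullet> (b - a) \<le> h b"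
proof -
  have "convex_on UNIV (\<lambda>s::real. h (a + s *\<^sub>R (b - a)))"
  proof (rule convex_onI)
    fix s x y :: real assume "0 < s" "s < 1"
    then have "h ((1 - s) *\<^sub>R (a + x *\<^sub>R (b - a)) + s *\<^sub>R (a + y *\<^sub>R (b - a)))
        \<le> (1 - s) * h (a + x *\<^sub>R (b - a)) + s * h (a + y *\<^sub>R (b - a))"
      by (intro convex_onD[OF assms(1)]) auto
    moreover have "(1 - s) *\<^sub>R (a + x *\<^sub>R (b - a)) + s *\<^sub>R (a + y *\<^sub>R (b - a))
        = a + ((1 - s) *\<^sub>R x + s *\<^sub>R y) *\<^sub>R (b - a)"
      by (simp add: algebra_simps)
    ultimately show "h (a + ((1 - s) *\<^sub>R x + s *\<^sub>R y) *\<^sub>R (b - a))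
        \<le> (1 - s) * h (a + x *\<^sub>R (b - a)) + s * h (a + y *\<^sub>R (b - a))"
      by simp
  qed simp
  moreover have "((\<lambda>s::real. h (a + s *\<^sub>R (b - a))) has_field_derivative G \<bullet> (b - a)) (at 0)"
  proof -
    have "((\<lambda>s::real. h (a + s *\<^sub>R (b - a))) has_derivative (\<lambda>s. G \<bullet> (s *\<^sub>R (b - a)))) (at 0)"
      using assms(2) unfolding gderiv_def
      by (intro has_derivative_compose[where f = "\<lambda>s::real. a + s *\<^sub>R (b - a)" and g = h])
        (auto intro!: derivative_eq_intros simp: inner_commute)
    then show ?thesis
      by (simp add: has_field_derivative_def mult.commute[of _ "G \<bullet> (b - a)"] mult_commute_abs)
  qed
  ultimately have "h (a + 1 *\<^sub>R (b - a)) - h (a + 0 *\<^sub>R (b - a)) \<ge> G \<bullet> (b - a) * (1 - 0)"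
    by (intro convex_on_imp_above_tangent[where A = UNIV]) auto
  then show ?thesis by simp
qed

text \<open>Along the segment from \<open>a\<close> to \<open>b\<close>, the difference of the two sides has derivative at most \<open>0\<close>
  by the Lipschitz condition.\<close>

lemma descent_lemma:
  fixes h :: "'a::real_inner \<Rightarrow> real" and L :: real
  assumes deriv: "\<And>x. GDERIV h x :> G x" and lip: "L-lipschitz_on UNIV G"
  shows "h b \<le> h a + G a \<bullet> (b - a) + L / 2 * (norm (b - a))\<^sup>2"
proof -
  define v where "v = b - a"
  define k where "k s = h (a + s *\<^sub>R v) - s * (G a \<bullet> v) - L / 2 * s\<^sup>2 * (norm v)\<^sup>2" for s :: real
  have "k 1 \<le> k 0"
  proof (rule DERIV_nonpos_imp_nonincreasing[where f = k and a = 0 and b = 1])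
    fix s :: real assume s: "0 \<le> s" "s \<le> 1"
    have "((\<lambda>s::real. h (a + s *\<^sub>R v)) has_derivative (\<lambda>r. G (a + s *\<^sub>R v) \<bullet> (r *\<^sub>R v))) (at s)"
      using deriv[of "a + s *\<^sub>R v"] unfolding gderiv_def
      by (intro has_derivative_compose[where f = "\<lambda>s::real. a + s *\<^sub>R v" and g = h])
        (auto intro!: derivative_eq_intros simp: inner_commute)
    then have "((\<lambda>s::real. h (a + s *\<^sub>R v)) has_field_derivative G (a + s *\<^sub>R v) \<bullet> v) (at s)"
      by (simp add: has_field_derivative_def mult_commute_abs)
    then have "(k has_field_derivative
        G (a + s *\<^sub>R v) \<bullet> v - G a \<bullet> v - L * s * (norm v)\<^sup>2) (at s)"
      unfolding k_def by (auto intro!: derivative_eq_intros)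
    moreover have "G (a + s *\<^sub>R v) \<bullet> v - G a \<bullet> v - L * s * (norm v)\<^sup>2 \<le> 0"
    proof -
      have "(G (a + s *\<^sub>R v) - G a) \<bullet> v \<le> norm (G (a + s *\<^sub>R v) - G a) * norm v"
        by (rule norm_cauchy_schwarz)
      also have "\<dots> \<le> (L * norm (s *\<^sub>R v)) * norm v"
        using lipschitz_on_normD[OF lip, of "a + s *\<^sub>R v" a] by (intro mult_right_mono) auto
      also have "\<dots> = L * s * (norm v)\<^sup>2"
        using s by (simp add: power2_eq_square)
      finally show ?thesis by (simp add: inner_diff_left)
    qed
    ultimately show "\<exists>y. DERIV k s :> y \<and> y \<le> 0" by blast
  qed simp
  then show ?thesis by (simp add: k_def v_def)
qed

text \<open>The gradient inequality at \<open>a\<close> and the descent lemma at \<open>b\<close> are compared at the point \<open>w\<close>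
  that a gradient step from \<open>b\<close> with step length \<open>1 / L\<close> reaches for the function
  \<open>h - G a \<bullet> _\<close>, which is minimal at \<open>a\<close>.\<close>

lemma cocoercivity:
  fixes h :: "'a::real_inner \<Rightarrow> real"
  assumes conv: "convex_on UNIV h" and deriv: "\<And>x. GDERIV h x :> G x"
    and lip: "L-lipschitz_on UNIV G" and L: "L > 0"
  shows "(norm (G b - G a))\<^sup>2 / (2 * L) \<le> h b - (h a + G a \<bullet> (b - a))"
proof -
  define w where "w = b - (1 / L) *\<^sub>R (G b - G a)"
  have "h a + G a \<bullet> (w - a) \<le> h b + G b \<bullet> (w - b) + L / 2 * (norm (w - b))\<^sup>2"
    using convex_gradient_inequality[OF conv deriv, of a w] descent_lemma[OF deriv lip, of w b]
    by linarith
  moreover have "L / 2 * (norm (w - b))\<^sup>2 = (norm (G b - G a))\<^sup>2 / (2 * L)"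
  proof -
    have "norm (w - b) = norm (G b - G a) / L"
      using L by (simp add: w_def del: scaleR_right_diff_distrib)
    then show ?thesis using L by (simp add: power2_eq_square)
  qed
  moreover have "G a \<bullet> (w - a) - G b \<bullet> (w - b) = G a \<bullet> (b - a) + (norm (G b - G a))\<^sup>2 / L"
    using L by (simp add: w_def power2_norm_eq_inner inner_simps inner_commute field_simps)
  moreover have "(norm (G b - G a))\<^sup>2 / L = 2 * ((norm (G b - G a))\<^sup>2 / (2 * L))"
    by simp
  ultimately show ?thesis by linarith
qed

section \<open>Proximal steps and averages\<close>

lemma norm_convex_combination_sq:
  fixes y z a :: "'a::real_inner"
  shows "(norm ((1 - s) *\<^sub>R y + s *\<^sub>R z - a))\<^sup>2
    = (1 - s) * (norm (y - a))\<^sup>2 + s * (norm (z - a))\<^sup>2 - s * (1 - s) * (norm (z - y))\<^sup>2"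
  by (simp add: power2_norm_eq_inner inner_simps inner_commute algebra_simps)

text \<open>The objective exceeds its minimum by at least the quadratic growth of its two proximal terms:
  compare \<open>y\<close> with the points of the segment from \<open>y\<close> to \<open>z\<close>, divide by the fraction of
  the segment travelled and let it tend to \<open>0\<close>. The two centres are those of the primal step, the centre of
  the phase and the previous inner iterate; the dual step is the case \<open>\<eta> = 0\<close>.\<close>

lemma prox_three_point:
  fixes \<phi> :: "'a::real_inner \<Rightarrow> real"
  assumes conv: "convex_on C \<phi>"
    and min: "is_arg_min (\<lambda>z. \<phi> z + \<eta> / 2 * (norm (z - a))\<^sup>2 + \<beta> / 2 * (norm (z - b))\<^sup>2)
                (\<lambda>z. z \<in> C) y"
    and z: "z \<in> C"
  shows "\<phi> y + \<eta> / 2 * (norm (y - a))\<^sup>2 + \<beta> / 2 * (norm (y - b))\<^sup>2 + (\<eta> + \<beta>) / 2 * (norm (z - y))\<^sup>2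
    \<le> \<phi> z + \<eta> / 2 * (norm (z - a))\<^sup>2 + \<beta> / 2 * (norm (z - b))\<^sup>2"
proof -
  define \<psi> where "\<psi> z = \<phi> z + \<eta> / 2 * (norm (z - a))\<^sup>2 + \<beta> / 2 * (norm (z - b))\<^sup>2" for z
  define q where "q = (\<eta> + \<beta>) / 2 * (norm (z - y))\<^sup>2"
  have y: "y \<in> C" and le: "\<And>v. v \<in> C \<Longrightarrow> \<psi> y \<le> \<psi> v"
    using min by (auto simp: is_arg_min_linorder \<psi>_def)
  have "\<psi> y + (1 - s) * q \<le> \<psi> z" if s: "0 < s" "s < 1" for s :: real
  proof -
    define v where "v = (1 - s) *\<^sub>R y + s *\<^sub>R z"
    have "v \<in> C"
      using conv y z s by (auto simp: v_def convex_on_def convex_def)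
    then have "\<psi> y \<le> \<psi> v" by (rule le)
    also have "\<psi> v \<le> (1 - s) * \<psi> y + s * \<psi> z - s * ((1 - s) * q)"
    proof -
      have "\<phi> v \<le> (1 - s) * \<phi> y + s * \<phi> z"
        unfolding v_def using s y z by (intro convex_onD[OF conv]) auto
      then show ?thesis
        unfolding \<psi>_def q_def norm_convex_combination_sq[of s y z, folded v_def]
        by (simp add: field_simps)
    qed
    finally have "s * (\<psi> y + (1 - s) * q) \<le> s * \<psi> z"
      by (simp add: algebra_simps)
    with s show ?thesis by simp
  qed
  then have ev: "eventually (\<lambda>s. \<psi> y + (1 - s) * q \<le> \<psi> z) (at_right (0::real))"
    by (auto simp: eventually_at_right_field intro!: exI[of _ 1])
  have "((\<lambda>s. \<psi> y + (1 - s) * q) \<longlongrightarrow> \<psi> y + (1 - 0) * q) (at_right (0::real))"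
    by (intro tendsto_intros)
  from tendsto_upperbound[OF this ev] show ?thesis
    by (simp add: \<psi>_def q_def)
qed

lemma convex_on_norm_sq:
  fixes a :: "'a::real_inner"
  assumes "convex C"
  shows "convex_on C (\<lambda>v. (norm (v - a))\<^sup>2)"
  using assms by (intro convex_onI) (simp_all add: norm_convex_combination_sq)

lemma weighted_jensen:
  fixes \<phi> :: "'a::real_vector \<Rightarrow> real"
  assumes conv: "convex_on C \<phi>" and I: "finite I"
    and a: "\<And>i. i \<in> I \<Longrightarrow> 0 \<le> a i" and pos: "sum a I > 0"
    and v: "\<And>i. i \<in> I \<Longrightarrow> v i \<in> C"
  shows "(1 / sum a I) *\<^sub>R (\<Sum>i\<in>I. a i *\<^sub>R v i) \<in> C"
    and "sum a I * \<phi> ((1 / sum a I) *\<^sub>R (\<Sum>i\<in>I. a i *\<^sub>R v i)) \<le> (\<Sum>i\<in>I. a i * \<phi> (v i))"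
proof -
  have avg: "(1 / sum a I) *\<^sub>R (\<Sum>i\<in>I. a i *\<^sub>R v i) = (\<Sum>i\<in>I. (a i / sum a I) *\<^sub>R v i)"
    by (simp add: scaleR_sum_right)
  have one: "(\<Sum>i\<in>I. a i / sum a I) = 1"
    using pos by (simp flip: sum_divide_distrib)
  have nn: "0 \<le> a i / sum a I" if "i \<in> I" for i
    using a[OF that] pos by simp
  have ne: "I \<noteq> {}" using pos by auto
  show "(1 / sum a I) *\<^sub>R (\<Sum>i\<in>I. a i *\<^sub>R v i) \<in> C"
    unfolding avg by (rule convex_sum[OF I convex_on_imp_convex[OF conv] one nn v])
  have "\<phi> (\<Sum>i\<in>I. (a i / sum a I) *\<^sub>R v i) \<le> (\<Sum>i\<in>I. a i / sum a I * \<phi> (v i))"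
    by (rule convex_on_sum[OF I ne conv one nn v])
  also have "\<dots> = (\<Sum>i\<in>I. a i * \<phi> (v i)) / sum a I"
    by (simp add: sum_divide_distrib)
  finally show "sum a I * \<phi> ((1 / sum a I) *\<^sub>R (\<Sum>i\<in>I. a i *\<^sub>R v i)) \<le> (\<Sum>i\<in>I. a i * \<phi> (v i))"
    using pos unfolding avg by (simp add: field_simps)
qed

section \<open>The outer loop: accelerated linearizations\<close>

text \<open>A linearization is affine, so its value at the extrapolated point \<open>e = (1 + \<tau>) b - \<tau> a\<close> is
  determined by its values at \<open>a\<close> and \<open>b\<close>. The differences on the right are Bregman distances
  of \<open>h\<close>. In dual terms this is the three-point identity of a proximal step in the gradient.\<close>

lemma linearization_gap_extrapolation:
  fixes h :: "'a::real_inner \<Rightarrow> real"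
  assumes xu: "(1 + \<tau>) *\<^sub>R b = \<tau> *\<^sub>R a + e"
  shows "(h z + G z \<bullet> (e - z)) - (h b + G b \<bullet> (e - b))
    = \<tau> * (h a - (h z + G z \<bullet> (a - z))) - (1 + \<tau>) * (h b - (h z + G z \<bullet> (b - z)))
      - \<tau> * (h a - (h b + G b \<bullet> (a - b)))"
proof -
  have e: "e = (1 + \<tau>) *\<^sub>R b - \<tau> *\<^sub>R a" using xu by simp
  show ?thesis unfolding e by (simp add: inner_simps algebra_simps)
qed

lemma momentum_young:
  fixes v w :: "'a::real_inner"
  assumes L: "L > 0" and r: "r \<ge> 0"
  shows "r * (v \<bullet> w) \<le> L * (norm v)\<^sup>2 + r * (r + 1) / 2 * ((norm w)\<^sup>2 / (2 * L))"
proof -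
  have "0 \<le> (norm (r *\<^sub>R w - (2 * L) *\<^sub>R v))\<^sup>2" by simp
  also have "\<dots> = r\<^sup>2 * (norm w)\<^sup>2 - 4 * L * (r * (v \<bullet> w)) + 4 * L * (L * (norm v)\<^sup>2)"
    unfolding power2_norm_eq_inner
    by (simp add: inner_simps inner_commute power2_eq_square algebra_simps)
  finally have "4 * L * (r * (v \<bullet> w)) \<le> 4 * L * (L * (norm v)\<^sup>2) + r\<^sup>2 * (norm w)\<^sup>2" by simp
  also have "r\<^sup>2 * (norm w)\<^sup>2 \<le> r * (r + 1) * (norm w)\<^sup>2"
    using r by (intro mult_right_mono) (auto simp: power2_eq_square algebra_simps)
  also have "4 * L * (L * (norm v)\<^sup>2) + \<dots>
      = 4 * L * (L * (norm v)\<^sup>2 + r * (r + 1) / 2 * ((norm w)\<^sup>2 / (2 * L)))"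
    using L by (simp add: field_simps)
  finally show ?thesis using L by simp
qed

text \<open>The induction carries the Bregman distance from \<open>xu N\<close> to \<open>z\<close> and the inner product of the last
  displacement with the gradient error at \<open>xu N\<close>. The weights \<open>t\<close> fit the averaging parameters
  \<open>(t - 1) / 2\<close> because \<open>N * (N + 1) / 2\<close> is both \<open>N * (1 + (N - 1) / 2)\<close> and
  \<open>(N + 1) * (N / 2)\<close>, so the Bregman distances to \<open>z\<close> telescope. When the inner product
  is passed on from phase \<open>N\<close> to \<open>N + 1\<close>, the gradient changes; the resulting cross term is paid by the
  Bregman distance between the consecutive points (\<open>cocoercivity\<close>) and by the
  squared displacement.\<close>

lemma accelerated_linearization_bound:
  fixes h :: "'a::real_inner \<Rightarrow> real" and X xt xu :: "nat \<Rightarrow> 'a"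
  assumes conv: "convex_on UNIV h" and deriv: "\<And>x. GDERIV h x :> G x"
    and lip: "L-lipschitz_on UNIV G" and L: "L > 0"
    and xt: "\<And>t. real (t + 1) *\<^sub>R xt (t + 1) = real (t + 1) *\<^sub>R X t + real t *\<^sub>R (X t - X (t - 1))"
    and xu: "\<And>t. (1 + real t / 2) *\<^sub>R xu (t + 1) = (real t / 2) *\<^sub>R xu t + xt (t + 1)"
  shows "(\<Sum>t=1..N. real t * ((h z + G z \<bullet> (X t - z)) - (h (xu t) + G (xu t) \<bullet> (X t - xu t))))
    \<le> L * (\<Sum>t=1..N. (norm (X t - X (t - 1)))\<^sup>2)"
proof -
  define B where "B a b = h a - (h b + G b \<bullet> (a - b))" for a b
  have coco: "(norm (G b - G a))\<^sup>2 / (2 * L) \<le> B a b" for a b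
    using cocoercivity[OF conv deriv lip L, of a b] by (simp add: B_def norm_minus_commute)
  define T where "T t = real t * ((h z + G z \<bullet> (X t - z)) - (h (xu t) + G (xu t) \<bullet> (X t - xu t)))" for t
  define d where "d t = X t - X (t - 1)" for t
  have ind: "(\<Sum>t=1..N. T t) + real N * (real N + 1) / 2 * B (xu N) z
      \<le> real N * (d N \<bullet> (G z - G (xu N))) + L * (\<Sum>t=1..<N. (norm (d t))\<^sup>2)" for N
  proof (induction N)
    case 0
    show ?case by simp
  next
    case (Suc N)
    have split: "(h z + G z \<bullet> (X (Suc N) - z)) - (h (xu (Suc N)) + G (xu (Suc N)) \<bullet> (X (Suc N) - xu (Suc N)))
      = (h z + G z \<bullet> (xt (Suc N) - z)) - (h (xu (Suc N)) + G (xu (Suc N)) \<bullet> (xt (Suc N) - xu (Suc N)))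
        + (X (Suc N) - xt (Suc N)) \<bullet> (G z - G (xu (Suc N)))"
      by (simp add: inner_simps inner_commute algebra_simps)
    have ext: "(h z + G z \<bullet> (xt (Suc N) - z)) - (h (xu (Suc N)) + G (xu (Suc N)) \<bullet> (xt (Suc N) - xu (Suc N)))
      = real N / 2 * B (xu N) z - (1 + real N / 2) * B (xu (Suc N)) z - real N / 2 * B (xu N) (xu (Suc N))"
      unfolding B_def using xu[of N] by (intro linearization_gap_extrapolation) simp
    have mom: "real (Suc N) *\<^sub>R (X (Suc N) - xt (Suc N)) = real (Suc N) *\<^sub>R d (Suc N) - real N *\<^sub>R d N"
      using xt[of N] by (simp add: d_def algebra_simps)
    have "real (Suc N) * ((X (Suc N) - xt (Suc N)) \<bullet> (G z - G (xu (Suc N))))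
        = (real (Suc N) *\<^sub>R (X (Suc N) - xt (Suc N))) \<bullet> (G z - G (xu (Suc N)))"
      by simp
    also have "\<dots> = real (Suc N) * (d (Suc N) \<bullet> (G z - G (xu (Suc N))))
        - real N * (d N \<bullet> (G z - G (xu N))) + real N * (d N \<bullet> (G (xu (Suc N)) - G (xu N)))"
      unfolding mom by (simp add: inner_simps algebra_simps)
    finally have T: "T (Suc N) + real (Suc N) * (real (Suc N) + 1) / 2 * B (xu (Suc N)) z
      = real N * (real N + 1) / 2 * B (xu N) z - real N * (real N + 1) / 2 * B (xu N) (xu (Suc N))
        + real (Suc N) * (d (Suc N) \<bullet> (G z - G (xu (Suc N))))
        - real N * (d N \<bullet> (G z - G (xu N))) + real N * (d N \<bullet> (G (xu (Suc N)) - G (xu N)))"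
      unfolding T_def split ext by (simp add: field_simps)
    have "real N * (real N + 1) / 2 * ((norm (G (xu (Suc N)) - G (xu N)))\<^sup>2 / (2 * L))
        \<le> real N * (real N + 1) / 2 * B (xu N) (xu (Suc N))"
      using coco[of "xu (Suc N)" "xu N"] by (intro mult_left_mono) auto
    then have young: "real N * (d N \<bullet> (G (xu (Suc N)) - G (xu N)))
        \<le> L * (norm (d N))\<^sup>2 + real N * (real N + 1) / 2 * B (xu N) (xu (Suc N))"
      using momentum_young[OF L, of "real N" "d N" "G (xu (Suc N)) - G (xu N)"] by linarith
    \<comment> \<open>also right for \<open>N = 0\<close>, where \<open>N - 1 = N\<close> makes the displacement vanish\<close>
    have d0: "(\<Sum>t=1..<Suc N. (norm (d t))\<^sup>2) = (\<Sum>t=1..<N. (norm (d t))\<^sup>2) + (norm (d N))\<^sup>2"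
      by (cases N) (simp_all add: d_def)
    have "(\<Sum>t=1..Suc N. T t) = (\<Sum>t=1..N. T t) + T (Suc N)" by simp
    then show ?case
      using Suc.IH T young unfolding d0 distrib_left by linarith
  qed
  have "real N * (real N + 1) / 2 * ((norm (G z - G (xu N)))\<^sup>2 / (2 * L))
      \<le> real N * (real N + 1) / 2 * B (xu N) z"
    using coco[of z "xu N"] by (intro mult_left_mono) auto
  then have "real N * (d N \<bullet> (G z - G (xu N)))
      \<le> L * (norm (d N))\<^sup>2 + real N * (real N + 1) / 2 * B (xu N) z"
    using momentum_young[OF L, of "real N" "d N" "G z - G (xu N)"] by linarith
  moreover have "(\<Sum>t=1..N. (norm (d t))\<^sup>2) = (\<Sum>t=1..<N. (norm (d t))\<^sup>2) + (norm (d N))\<^sup>2"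
    by (cases N) (simp_all add: d_def atLeastLessThanSuc_atLeastAtMost)
  ultimately have "(\<Sum>t=1..N. T t) \<le> L * (\<Sum>t=1..N. (norm (d t))\<^sup>2)"
    using ind[of N] by (simp add: distrib_left)
  then show ?thesis by (simp add: T_def d_def)
qed

section \<open>The inner loop: one primal-dual step\<close>

lemma bilinear_young:
  fixes A :: "real ^ 'n ^ 'm"
  assumes w: "w \<ge> 0" and le: "w * op_norm A \<le> K / R" and K: "K > 0" and R: "R > 0"
  shows "\<bar>w * (v \<bullet> (A *v z))\<bar> \<le> K / 2 * (norm z)\<^sup>2 + K / (2 * R\<^sup>2) * (norm v)\<^sup>2"
proof -
  have "\<bar>w * (v \<bullet> (A *v z))\<bar> \<le> w * (norm v * (op_norm A * norm z))"
    using w onorm[OF matrix_vector_mul_bounded_linear[of A], of z]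
    by (auto simp: abs_mult op_norm_def
        intro!: mult_left_mono order_trans[OF Cauchy_Schwarz_ineq2] mult_left_mono)
  also have "\<dots> = (w * op_norm A) * (norm v * norm z)" by simp
  also have "\<dots> \<le> (K / R) * (norm v * norm z)"
    using le by (intro mult_right_mono) auto
  also have "\<dots> = K / 2 * (2 * (norm v / R) * norm z)" by simp
  also have "\<dots> \<le> K / 2 * ((norm v / R)\<^sup>2 + (norm z)\<^sup>2)"
    using K sum_squares_bound[of "norm v / R" "norm z"] by (intro mult_left_mono) auto
  also have "\<dots> = K / 2 * (norm z)\<^sup>2 + K / (2 * R\<^sup>2) * (norm v)\<^sup>2"
    by (simp add: power_divide algebra_simps)
  finally show ?thesis .
qed

text \<open>The potential after an inner step with Jacobian \<open>A\<close> and weight \<open>w\<close> that has reached the pair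
  \<open>(y, l1)\<close> from the multiplier \<open>l0\<close>, measured against the comparison pair \<open>(z, l)\<close>. The
  squared multiplier displacement and the bilinear summand account for the extrapolation: the next step uses \<open>l1 - l0\<close> in place of the
  change of the multiplier that it has not made yet.\<close>

definition pd_potential ::
  "real \<Rightarrow> real \<Rightarrow> real ^ 'n \<Rightarrow> real ^ 'm \<Rightarrow> real \<Rightarrow> real ^ 'n ^ 'm \<Rightarrow> real ^ 'n \<Rightarrow> real ^ 'm \<Rightarrow> real ^ 'm \<Rightarrow> real" where
  "pd_potential K R z l w A y l1 l0 =
     K / 2 * (norm (z - y))\<^sup>2 + K / (2 * R\<^sup>2) * ((norm (l - l1))\<^sup>2 + (norm (l1 - l0))\<^sup>2)
     - w * ((l1 - l0) \<bullet> (A *v (y - z)))"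

lemma pd_potential_nonneg:
  assumes "w \<ge> 0" "w * op_norm A \<le> K / R" "K > 0" "R > 0"
  shows "0 \<le> pd_potential K R z l w A y l1 l0"
proof -
  have "\<bar>w * ((l1 - l0) \<bullet> (A *v (y - z)))\<bar>
      \<le> K / 2 * (norm (z - y))\<^sup>2 + K / (2 * R\<^sup>2) * (norm (l1 - l0))\<^sup>2"
    using bilinear_young[OF assms, of "l1 - l0" "y - z"] by (simp add: norm_minus_commute)
  moreover have "0 \<le> K / (2 * R\<^sup>2) * (norm (l - l1))\<^sup>2" using assms by simp
  ultimately show ?thesis
    unfolding pd_potential_def distrib_left by linarith
qed

lemma inner_nonneg_vec:
  fixes a b :: "real ^ 'm"
  assumes "0 \<le> a" "b \<le> 0"
  shows "a \<bullet> b \<le> 0"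
  using assms by (auto simp: inner_vec_def less_eq_vec_def intro!: sum_nonpos mult_nonneg_nonpos)

text \<open>The two proximal inequalities are added. What remains of the bilinear terms is the error of
  the extrapolation. Its part at \<open>y'\<close> belongs to the old potential and its part at \<open>y\<close>
  to the new one; the rest, which involves \<open>y - y'\<close>, is absorbed by the squared primal
  displacement and by the squared multiplier displacement kept in the old potential
  (\<open>bilinear_young\<close>). Primed variables belong to the previous step; its weight and its Jacobian may
  differ, because it may lie in the previous phase.\<close>

lemma primal_dual_step:
  fixes A A' :: "real ^ 'n ^ 'm" and y y' z a b p h :: "real ^ 'n" and l l1 l0 l' q :: "real ^ 'm"
  assumes K: "K > 0" and R: "R > 0"
    and w: "w > 0" and w_beta: "w * \<beta> = K" and w_gamma: "w * \<gamma> = K / R\<^sup>2"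
    and w': "w' \<ge> 0" and coupling: "w' * op_norm A' \<le> K / R"
    and h: "w *\<^sub>R h = w *\<^sub>R (transpose A *v l0) + w' *\<^sub>R (transpose A' *v (l0 - l'))"
    and conv: "convex_on C u" and z: "z \<in> C"
    and primal: "is_arg_min (\<lambda>v. (h + p) \<bullet> v + u v + \<eta> / 2 * (norm (v - a))\<^sup>2
                    + \<beta> / 2 * (norm (v - y'))\<^sup>2) (\<lambda>v. v \<in> C) y"
    and dual: "is_arg_max (\<lambda>v. v \<bullet> (A *v (y - b) + q) - \<gamma> / 2 * (norm (v - l0))\<^sup>2)
                    (\<lambda>v. 0 \<le> v) l1"
    and l: "0 \<le> l" and feasible: "A *v (z - b) + q \<le> 0"
  shows "w * (u y - u z + p \<bullet> (y - z) + l \<bullet> (A *v (y - b) + q))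
      + w * \<eta> / 2 * ((norm (y - a))\<^sup>2 + (norm (z - y))\<^sup>2 - (norm (z - a))\<^sup>2)
    \<le> pd_potential K R z l w' A' y' l0 l' - pd_potential K R z l w A y l1 l0"
proof -
  define q' where "q' = A *v (y - b) + q"
  have lin_u: "convex_on C (\<lambda>v. (h + p) \<bullet> v + u v)"
    using convex_on_imp_convex[OF conv]
    by (intro convex_on_add[OF _ conv] convex_onI) (auto simp: inner_simps)
  have "((h + p) \<bullet> y + u y) + \<eta> / 2 * (norm (y - a))\<^sup>2 + \<beta> / 2 * (norm (y - y'))\<^sup>2
      + (\<eta> + \<beta>) / 2 * (norm (z - y))\<^sup>2
    \<le> ((h + p) \<bullet> z + u z) + \<eta> / 2 * (norm (z - a))\<^sup>2 + \<beta> / 2 * (norm (z - y'))\<^sup>2"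
    by (rule prox_three_point[OF lin_u primal z])
  then have "w * (((h + p) \<bullet> y + u y) + \<eta> / 2 * (norm (y - a))\<^sup>2 + \<beta> / 2 * (norm (y - y'))\<^sup>2
      + (\<eta> + \<beta>) / 2 * (norm (z - y))\<^sup>2)
    \<le> w * (((h + p) \<bullet> z + u z) + \<eta> / 2 * (norm (z - a))\<^sup>2 + \<beta> / 2 * (norm (z - y'))\<^sup>2)"
    using w by simp
  moreover have "w * ((h + p) \<bullet> z) = (w *\<^sub>R h) \<bullet> z + w * (p \<bullet> z)"
    "w * ((h + p) \<bullet> y) = (w *\<^sub>R h) \<bullet> y + w * (p \<bullet> y)"
    by (simp_all add: inner_simps algebra_simps)
  ultimately have P: "w * (u y - u z + p \<bullet> (y - z)) + (w *\<^sub>R h) \<bullet> (y - z)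
      + w * \<eta> / 2 * ((norm (y - a))\<^sup>2 + (norm (z - y))\<^sup>2 - (norm (z - a))\<^sup>2)
      + (w * \<beta>) / 2 * ((norm (y - y'))\<^sup>2 + (norm (z - y))\<^sup>2 - (norm (z - y'))\<^sup>2) \<le> 0"
    by (simp add: inner_diff_right field_simps)
  have hyz: "(w *\<^sub>R h) \<bullet> (y - z) = w * (l0 \<bullet> (A *v (y - z)))
      + w' * ((l0 - l') \<bullet> (A' *v (y' - z))) + w' * ((l0 - l') \<bullet> (A' *v (y - y')))"
  proof -
    have "A' *v (y - z) = A' *v (y' - z) + A' *v (y - y')"
      by (simp flip: matrix_vector_right_distrib)
    then show ?thesis
      unfolding h by (simp add: inner_add_left dot_lmul_matrix inner_add_right distrib_left)
  qed
  have cone: "convex_on {v :: real ^ 'm. 0 \<le> v} (\<lambda>v. - (v \<bullet> q'))"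
    by (intro convex_onI) (auto simp: inner_simps convex_def less_eq_vec_def)
  have dual': "is_arg_min (\<lambda>v. - (v \<bullet> q') + 0 / 2 * (norm (v - l0))\<^sup>2 + \<gamma> / 2 * (norm (v - l0))\<^sup>2)
      (\<lambda>v. v \<in> {v. 0 \<le> v}) l1"
    using dual by (auto simp: is_arg_min_linorder is_arg_max_linorder q'_def)
  have "- (l1 \<bullet> q') + 0 / 2 * (norm (l1 - l0))\<^sup>2 + \<gamma> / 2 * (norm (l1 - l0))\<^sup>2
      + (0 + \<gamma>) / 2 * (norm (l - l1))\<^sup>2
    \<le> - (l \<bullet> q') + 0 / 2 * (norm (l - l0))\<^sup>2 + \<gamma> / 2 * (norm (l - l0))\<^sup>2"
    using l by (intro prox_three_point[OF cone dual']) simp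
  then have "w * (- (l1 \<bullet> q') + \<gamma> / 2 * (norm (l1 - l0))\<^sup>2 + \<gamma> / 2 * (norm (l - l1))\<^sup>2)
    \<le> w * (- (l \<bullet> q') + \<gamma> / 2 * (norm (l - l0))\<^sup>2)"
    using w by simp
  then have Q: "w * (l \<bullet> q') + (w * \<gamma>) / 2 * ((norm (l1 - l0))\<^sup>2 + (norm (l - l1))\<^sup>2 - (norm (l - l0))\<^sup>2)
      \<le> w * (l1 \<bullet> q')"
    by (simp add: field_simps)
  have q'_split: "w * (l1 \<bullet> q') \<le> w * (l1 \<bullet> (A *v (y - z)))"
  proof -
    have "0 \<le> l1" using dual by (simp add: is_arg_max_linorder)
    then have "l1 \<bullet> (A *v (z - b) + q) \<le> 0" using feasible by (rule inner_nonneg_vec)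
    moreover have "q' = (A *v (z - b) + q) + A *v (y - z)"
      by (simp add: q'_def matrix_vector_mult_diff_distrib)
    ultimately have "l1 \<bullet> q' \<le> l1 \<bullet> (A *v (y - z))" by (simp add: inner_add_right)
    then show ?thesis using w by simp
  qed
  have young: "- (w' * ((l0 - l') \<bullet> (A' *v (y - y'))))
      \<le> K / 2 * (norm (y - y'))\<^sup>2 + K / (2 * R\<^sup>2) * (norm (l0 - l'))\<^sup>2"
    using bilinear_young[OF w' coupling K R, of "l0 - l'" "y - y'"] by linarith
  have "w * ((l1 - l0) \<bullet> (A *v (y - z))) = w * (l1 \<bullet> (A *v (y - z))) - w * (l0 \<bullet> (A *v (y - z)))"
    by (simp add: inner_diff_left right_diff_distrib)
  with P Q q'_split young show ?thesis
    unfolding hyz w_beta w_gamma pd_potential_def q'_def[symmetric]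
    by (simp add: algebra_simps add_divide_distrib diff_divide_distrib)
qed

section \<open>Runs of the method\<close>

text \<open>The standing hypotheses of the convergence theorem: \<open>(xs, ls)\<close> is the KKT pair and \<open>LL\<close> is the
  constant \<open>L(\<Lambda>\<^sub>c)\<close>.\<close>

locale acgd_s =
  fixes X D :: "(real ^ 'n) set"
    and f u :: "real ^ 'n \<Rightarrow> real" and gradf :: "real ^ 'n \<Rightarrow> real ^ 'n"
    and g :: "real ^ 'n \<Rightarrow> real ^ 'm" and J :: "real ^ 'n \<Rightarrow> real ^ 'n ^ 'm"
    and xs x0 :: "real ^ 'n" and ls :: "real ^ 'm"
    and L :: "real ^ 'm \<Rightarrow> real" and c R LL d \<Delta> :: real
    and \<tau> \<eta> \<omega> \<theta> M Mt :: "nat \<Rightarrow> real" and S :: "nat \<Rightarrow> nat"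
    and \<rho> \<beta> \<gamma> \<delta> :: "nat \<Rightarrow> nat \<Rightarrow> real"
    and x :: "int \<Rightarrow> real ^ 'n" and xt xu p :: "nat \<Rightarrow> real ^ 'n"
    and nu :: "nat \<Rightarrow> real ^ 'n ^ 'm"
    and h y :: "nat \<Rightarrow> nat \<Rightarrow> real ^ 'n" and lam :: "nat \<Rightarrow> int \<Rightarrow> real ^ 'm"
  assumes problem: "smooth_convex_problem X f gradf g J D u"
    and kkt: "kkt_pair X f gradf g J D u xs ls"
    and L_lipschitz: "\<And>l. 0 \<le> l \<Longrightarrow> (L l)-lipschitz_on UNIV (lagrangian_grad gradf J l)"
    and L_bdd: "bdd_above (L ` multiplier_set ls c)"
    and LL_def: "LL = (SUP l\<in>multiplier_set ls c. L l)"
    and LL_pos: "LL > 0"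
    and c: "c \<ge> 1" and R: "R > 0"
    and d_def: "d = norm ls + c"
    and run: "acgd_s_run X gradf g J u \<tau> \<eta> \<theta> S \<rho> \<beta> \<gamma> \<delta> x0 x xt xu p nu h y lam"
    and tau: "\<And>t. t \<ge> 1 \<Longrightarrow> \<tau> t = (real t - 1) / 2"
    and eta: "\<And>t. t \<ge> 1 \<Longrightarrow> \<eta> t = LL / \<tau> (t + 1)"
    and omega: "\<And>t. t \<ge> 1 \<Longrightarrow> \<omega> t = real t"
    and theta: "\<And>t. t \<ge> 1 \<Longrightarrow> \<theta> (t + 1) = \<omega> t / \<omega> (t + 1)"
    and M: "\<And>t. t \<ge> 1 \<Longrightarrow> M t = (if op_norm (nu t) > 0 then op_norm (nu t) else 1)"
    and Delta: "\<Delta> = R / LL"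
    and S: "\<And>t. t \<ge> 1 \<Longrightarrow> S t = nat \<lceil>M t * \<Delta> * real t\<rceil>"
    and Mt: "\<And>t. t \<ge> 1 \<Longrightarrow> Mt t = real (S t) / (\<Delta> * real t)"
    and rho: "\<And>t s. t \<ge> 1 \<Longrightarrow> s \<ge> 1 \<Longrightarrow>
               \<rho> t s = (if s = 1 \<and> t \<ge> 2 then Mt t / Mt (t - 1) else 1)"
    and beta: "\<And>t s. t \<ge> 1 \<Longrightarrow> s \<ge> 1 \<Longrightarrow> \<beta> t s = Mt t * R"
    and gamma: "\<And>t s. t \<ge> 1 \<Longrightarrow> s \<ge> 1 \<Longrightarrow> \<gamma> t s = Mt t / R"
    and delta: "\<And>t s. t \<ge> 1 \<Longrightarrow> s \<ge> 1 \<Longrightarrow> \<delta> t s = 1"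
begin

abbreviation iterate :: "nat \<Rightarrow> real ^ 'n" where "iterate t \<equiv> x (int t)"

abbreviation F_opt :: real where "F_opt \<equiv> f xs + u xs"

text \<open>The weight of an inner step: the weight \<open>t\<close> of phase \<open>t\<close> is shared equally by its \<open>S t\<close>
  steps. The value \<open>0\<close> at \<open>t = 0\<close> suits the first step of the run, which has no predecessor.\<close>

definition step_weight :: "nat \<Rightarrow> real" where "step_weight t = real t / real (S t)"

definition lagr :: "real ^ 'm \<Rightarrow> real ^ 'n \<Rightarrow> real" where "lagr l z = f z + l \<bullet> g z"

abbreviation lagr_grad :: "real ^ 'm \<Rightarrow> real ^ 'n \<Rightarrow> real ^ 'n" where
  "lagr_grad \<equiv> lagrangian_grad gradf J"

lemma lagr_grad_inner: "lagr_grad l a \<bullet> v = gradf a \<bullet> v + l \<bullet> (J a *v v)"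
  by (simp add: lagrangian_grad_def inner_vec_def[of l] matrix_vector_mul_component inner_simps inner_sum_left)

lemma
  shows convex_X: "convex X" and convex_u_D: "convex_on D u" and X_sub_D: "X \<subseteq> D"
    and convex_f: "convex_on UNIV f" and convex_g: "convex_on UNIV (\<lambda>x. g x $ i)"
    and deriv_f: "GDERIV f a :> gradf a"
    and deriv_g: "(g has_derivative (*v) (J a)) (at a)"
  using problem by (auto simp: smooth_convex_problem_def)

lemma convex_u: "convex_on X u"
  using convex_u_D X_sub_D convex_X by (rule convex_on_subset)

lemma deriv_g_component: "GDERIV (\<lambda>x. g x $ i) a :> J a $ i"
proof -
  have "((\<lambda>x. g x $ i) has_derivative (\<lambda>v. (J a *v v) $ i)) (at a)"
    by (rule bounded_linear.has_derivative[OF bounded_linear_vec_nth deriv_g])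
  then show ?thesis by (simp add: gderiv_def matrix_vector_mul_component inner_commute)
qed

lemma deriv_lagr: "GDERIV (lagr l) a :> lagr_grad l a"
proof -
  have "(f has_derivative (\<lambda>v. gradf a \<bullet> v)) (at a)"
    using deriv_f[of a] by (simp add: gderiv_def inner_commute)
  then have "((\<lambda>z. f z + l \<bullet> g z) has_derivative (\<lambda>v. gradf a \<bullet> v + l \<bullet> (J a *v v))) (at a)"
    by (intro has_derivative_add has_derivative_inner_right deriv_g)
  then show ?thesis
    by (simp add: gderiv_def lagr_def[abs_def] lagr_grad_inner inner_commute[of _ "lagr_grad l a"])
qed

lemma convex_lagr:
  assumes "0 \<le> l" shows "convex_on UNIV (lagr l)"
proof -
  have "convex_on UNIV (\<lambda>z. l \<bullet> g z)"
  proof (rule convex_onI)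
    fix s :: real and a b assume s: "0 < s" "s < 1"
    have "l \<bullet> g ((1 - s) *\<^sub>R a + s *\<^sub>R b)
        \<le> (\<Sum>i\<in>UNIV. l $ i * ((1 - s) * g a $ i + s * g b $ i))"
      unfolding inner_vec_def inner_real_def using s assms
      by (intro sum_mono mult_left_mono convex_onD[OF convex_g]) (auto simp: less_eq_vec_def)
    also have "\<dots> = (1 - s) * (l \<bullet> g a) + s * (l \<bullet> g b)"
      by (simp add: inner_vec_def sum_distrib_left distrib_left sum.distrib mult.left_commute)
    finally show "l \<bullet> g ((1 - s) *\<^sub>R a + s *\<^sub>R b) \<le> (1 - s) * (l \<bullet> g a) + s * (l \<bullet> g b)" .
  qed simp
  then show ?thesis
    unfolding lagr_def[abs_def] by (intro convex_on_add convex_f)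
qed

lemma
  shows xs_X: "xs \<in> X" and g_xs: "g xs \<le> 0" and ls_nonneg: "0 \<le> ls"
    and stationary: "\<exists>u'\<in>subdifferential D u xs. - (lagr_grad ls xs + u') \<in> normal_cone X xs"
  using kkt by (auto simp: kkt_pair_def is_arg_min_def)

lemma compl_slack: "ls \<bullet> g xs = 0"
  using kkt unfolding kkt_pair_def inner_vec_def inner_real_def by (intro sum.neutral) blast

text \<open>By stationarity and convexity, \<open>xs\<close> minimizes the Lagrangian at \<open>ls\<close> over \<open>X\<close>, and complementary slackness
  makes the minimum equal to the optimal value.\<close>

lemma lagr_kkt_lower_bound:
  assumes "z \<in> X" shows "F_opt \<le> lagr ls z + u z"
proof -
  obtain u' where u': "u' \<in> subdifferential D u xs" "- (lagr_grad ls xs + u') \<in> normal_cone X xs"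
    using stationary by blast
  have "0 \<le> (lagr_grad ls xs + u') \<bullet> (z - xs)"
    using u'(2) assms by (auto simp: normal_cone_def inner_simps)
  moreover have "u xs + u' \<bullet> (z - xs) \<le> u z"
    using u'(1) assms X_sub_D by (auto simp: subdifferential_def)
  moreover have "lagr ls xs + lagr_grad ls xs \<bullet> (z - xs) \<le> lagr ls z"
    by (rule convex_gradient_inequality[OF convex_lagr[OF ls_nonneg] deriv_lagr])
  ultimately show ?thesis by (simp add: lagr_def compl_slack inner_add_left)
qed

text \<open>Convex functions lie above their linearizations, so \<open>xs\<close> satisfies the linearized constraints of
  every phase, and nonnegative multipliers of these constraints contribute nothing positive at \<open>xs\<close>.\<close>

lemma linearized_feasible: "J a *v (xs - a) + g a \<le> 0"
proof -
  have "J a $ i \<bullet> (xs - a) + g a $ i \<le> 0" for i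
  proof -
    have "g a $ i + J a $ i \<bullet> (xs - a) \<le> g xs $ i"
      by (rule convex_gradient_inequality[OF convex_g deriv_g_component])
    also have "\<dots> \<le> 0" using g_xs by (simp add: less_eq_vec_def)
    finally show ?thesis by simp
  qed
  then show ?thesis by (simp add: less_eq_vec_def matrix_vector_mul_component)
qed

lemma multiplier_nonneg: "l \<in> multiplier_set ls c \<Longrightarrow> 0 \<le> l"
  using ls_nonneg by (auto simp: multiplier_set_def)

lemma LL_lipschitz:
  assumes "l \<in> multiplier_set ls c" shows "LL-lipschitz_on UNIV (lagr_grad l)"
  using L_lipschitz[OF multiplier_nonneg[OF assms]] cSUP_upper[OF assms L_bdd]
  by (auto simp: LL_def intro: lipschitz_on_le)

section \<open>Stepsizes and weights\<close>

lemma M_pos: "t \<ge> 1 \<Longrightarrow> 0 < M t" and op_norm_le_M: "t \<ge> 1 \<Longrightarrow> op_norm (nu t) \<le> M t"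
  by (auto simp: M)

lemma S_pos: assumes "t \<ge> 1" shows "S t \<ge> 1"
proof -
  have "0 < M t * \<Delta> * real t" using M_pos[OF assms] R LL_pos assms by (simp add: Delta)
  then show ?thesis unfolding S[OF assms] by linarith
qed

lemma S_ge: "t \<ge> 1 \<Longrightarrow> M t * \<Delta> * real t \<le> real (S t)"
  unfolding S by linarith

lemma S_le: assumes "t \<ge> 1" shows "real (S t) \<le> M t * \<Delta> * real t + 1"
proof -
  have "0 < M t * \<Delta> * real t" using M_pos[OF assms] R LL_pos assms by (simp add: Delta)
  then show ?thesis using S[OF assms] by linarith
qed

lemma step_weight_nonneg: "0 \<le> step_weight t" by (simp add: step_weight_def)

lemma step_weight_pos: "t \<ge> 1 \<Longrightarrow> 0 < step_weight t" using S_pos[of t] by (simp add: step_weight_def)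

lemma step_weight_Mt: assumes "t \<ge> 1" shows "step_weight t * Mt t = LL / R"
  using assms S_pos[OF assms] R LL_pos by (simp add: step_weight_def Mt Delta field_simps)

text \<open>This is the reason for rounding \<open>M t * \<Delta> * t\<close> up: the weighted coupling of the primal and the dual steps
  never exceeds the geometric mean of the weighted proximal coefficients \<open>LL\<close> and \<open>LL / R\<^sup>2\<close>.\<close>

lemma coupling: assumes "t \<ge> 1" shows "step_weight t * op_norm (nu t) \<le> LL / R"
proof -
  have "op_norm (nu t) * (\<Delta> * real t) \<le> M t * (\<Delta> * real t)"
    using op_norm_le_M[OF assms] R LL_pos by (intro mult_right_mono) (auto simp: Delta)
  then have "op_norm (nu t) * (R / LL * real t) \<le> real (S t)"
    using S_ge[OF assms] by (simp add: Delta mult.assoc)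
  then show ?thesis
    using S_pos[OF assms] R LL_pos by (simp add: step_weight_def field_simps)
qed

lemma coupling_0: "step_weight 0 * op_norm (nu 0) \<le> LL / R"
  using R LL_pos by (simp add: step_weight_def)

lemma step_weight_rho_1:
  assumes t: "t \<ge> 2" shows "step_weight t * \<rho> t 1 = step_weight (t - 1)"
proof -
  have "t - 1 \<ge> 1" using t by simp
  note prev = step_weight_Mt[OF this]
  have "Mt (t - 1) \<noteq> 0" using prev R LL_pos by auto
  moreover have "step_weight t * Mt t = step_weight (t - 1) * Mt (t - 1)" using step_weight_Mt[of t] prev t by simp
  ultimately show ?thesis using t by (simp add: rho field_simps)
qed

lemma
  shows x0_X: "x0 \<in> X" and iterate_0: "x 0 = x0" and x_m1: "x (- 1) = x0" and xu_0: "xu 0 = x0"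
    and y_init: "y 1 0 = x0" and lam_init: "lam 1 0 = 0" "lam 1 (- 1) = 0"
  using run by (auto simp: acgd_s_run_def)

context
  fixes t :: nat assumes t: "t \<ge> 1"
begin

text \<open>The clause of the run that describes phase \<open>t\<close>; nine initial conditions precede it.\<close>

lemmas phase = run[unfolded acgd_s_run_def, THEN conjunct2, THEN conjunct2, THEN conjunct2,
    THEN conjunct2, THEN conjunct2, THEN conjunct2, THEN conjunct2, THEN conjunct2,
    THEN conjunct2, THEN spec, THEN mp, OF t]

lemma
  shows xt_eq: "xt t = x (int t - 1) + \<theta> t *\<^sub>R (x (int t - 1) - x (int t - 2))"
    and xu_eq: "xu t = (1 / (1 + \<tau> t)) *\<^sub>R (\<tau> t *\<^sub>R xu (t - 1) + xt t)"
    and p_eq: "p t = gradf (xu t)" and nu_eq: "nu t = J (xu t)"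
    and lam_next: "lam (t + 1) 0 = lam t (int (S t))"
    and lam_next': "lam (t + 1) (- 1) = lam t (int (S t) - 1)"
    and y_next: "y (t + 1) 0 = y t (S t)"
    and iterate_avg: "iterate t = (1 / (\<Sum>s=1..S t. \<delta> t s)) *\<^sub>R (\<Sum>s=1..S t. \<delta> t s *\<^sub>R y t s)"
  using phase by - (elim conjE, assumption)+

lemma sum_delta: "(\<Sum>s=1..S t. \<delta> t s) = real (S t)"
  using delta t by simp

lemma
  assumes s: "s \<in> {1..S t}"
  shows h_1: "s = 1 \<Longrightarrow> h t s = transpose (nu t) *v lam t 0
           + \<rho> t 1 *\<^sub>R (transpose (nu (t - 1)) *v (lam t 0 - lam t (- 1)))"
    and h_2: "s \<noteq> 1 \<Longrightarrow> h t s = transpose (nu t) *v lam t (int s - 1)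
           + \<rho> t s *\<^sub>R (transpose (nu t) *v (lam t (int s - 1) - lam t (int s - 2)))"
    and y_min: "is_arg_min
             (\<lambda>z. (h t s + p t) \<bullet> z + u z + \<eta> t / 2 * (norm (z - x (int t - 1)))\<^sup>2
                  + \<beta> t s / 2 * (norm (z - y t (s - 1)))\<^sup>2)
             (\<lambda>z. z \<in> X) (y t s)"
    and lam_max: "is_arg_max
             (\<lambda>l. l \<bullet> (nu t *v (y t s - xu t) + g (xu t))
                  - \<gamma> t s / 2 * (norm (l - lam t (int s - 1)))\<^sup>2)
             (\<lambda>l. 0 \<le> l) (lam t (int s))"
  using phase[THEN conjunct2, THEN conjunct2, THEN conjunct2, THEN conjunct2, THEN conjunct1,
      THEN bspec, OF s]
  by - (elim conjE, simp only: refl if_True if_False; fail)+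

lemma y_X: "s \<in> {1..S t} \<Longrightarrow> y t s \<in> X"
  using y_min by (simp add: is_arg_min_def)

end

section \<open>Descent of the potential through all phases\<close>

lemma momentum: "real (t + 1) *\<^sub>R xt (t + 1) = real (t + 1) *\<^sub>R iterate t + real t *\<^sub>R (iterate t - iterate (t - 1))"
proof (cases "t = 0")
  case True
  then show ?thesis using xt_eq[of 1] iterate_0 x_m1 by simp
next
  case False
  then have t: "t \<ge> 1" by simp
  have "int (t - 1) = int t - 1" using t by simp
  moreover have "\<theta> (t + 1) = real t / real (t + 1)"
    using theta[OF t] omega[OF t] omega[of "t + 1"] by simp
  ultimately show ?thesis
    using xt_eq[of "t + 1"] by (simp add: scaleR_add_right)
qed

lemma averaging: "(1 + real t / 2) *\<^sub>R xu (t + 1) = (real t / 2) *\<^sub>R xu t + xt (t + 1)"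
proof -
  have \<tau>: "\<tau> (t + 1) = real t / 2" and "1 + real t / 2 \<noteq> 0"
    using tau[of "t + 1"] by simp_all
  then show ?thesis
    using xu_eq[of "t + 1"] unfolding \<tau> by simp
qed

text \<open>At the start of a phase the last step made belongs to the previous one, so the potential uses its
  weight and Jacobian.\<close>

definition potential :: "real ^ 'm \<Rightarrow> nat \<Rightarrow> nat \<Rightarrow> real" where
  "potential l t s = (if s = 0
     then pd_potential LL R xs l (step_weight (t - 1)) (nu (t - 1)) (y t 0) (lam t 0) (lam t (- 1))
     else pd_potential LL R xs l (step_weight t) (nu t) (y t s) (lam t (int s)) (lam t (int s - 1)))"

lemma potential_next: "t \<ge> 1 \<Longrightarrow> potential l (t + 1) 0 = potential l t (S t)"
  using S_pos[of t] lam_next[of t] lam_next'[of t] y_next[of t] by (simp add: potential_def)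

lemma potential_nonneg: "0 \<le> potential l t s"
proof -
  have "step_weight t * op_norm (nu t) \<le> LL / R" for t
    using coupling[of t] coupling_0 by (cases "t = 0") auto
  then show ?thesis
    unfolding potential_def using step_weight_nonneg LL_pos R by (auto intro!: pd_potential_nonneg)
qed

lemma potential_init: "potential l 1 0 = LL / 2 * (norm (x0 - xs))\<^sup>2 + LL / (2 * R\<^sup>2) * (norm l)\<^sup>2"
  using y_init lam_init by (simp add: potential_def pd_potential_def step_weight_def norm_minus_commute)

lemma step_weight_h:
  assumes t: "t \<ge> 1" and s: "s \<in> {1..S t}"
  shows "step_weight t *\<^sub>R h t s = step_weight t *\<^sub>R (transpose (nu t) *v lam t (int s - 1)) +
    (if s = 1 then step_weight (t - 1) *\<^sub>R (transpose (nu (t - 1)) *v (lam t 0 - lam t (- 1)))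
     else step_weight t *\<^sub>R (transpose (nu t) *v (lam t (int s - 1) - lam t (int s - 2))))"
proof (cases "s = 1")
  case True
  show ?thesis
  proof (cases "t = 1")
    case True
    then show ?thesis using h_1[OF t s] \<open>s = 1\<close> lam_init by simp
  next
    case False
    then have "step_weight t * \<rho> t 1 = step_weight (t - 1)" using t by (intro step_weight_rho_1) simp
    then show ?thesis using h_1[OF t s] \<open>s = 1\<close> by (simp add: scaleR_add_right)
  qed
next
  case False
  then have "\<rho> t s = 1" using t s by (simp add: rho)
  then show ?thesis using h_2[OF t s] False by (simp add: scaleR_add_right)
qed

text \<open>The first step of a phase has its predecessor in the previous phase, all others in their own;
  in the very first phase the multiplier has not moved yet and the weight \<open>0\<close> of the
  missing phase does no harm (\<open>step_weight_h\<close>).\<close>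

lemma inner_step:
  assumes t: "t \<ge> 1" and s: "s \<in> {1..S t}" and l: "0 \<le> l"
  shows "step_weight t * (u (y t s) - u xs + p t \<bullet> (y t s - xs) + l \<bullet> (nu t *v (y t s - xu t) + g (xu t)))
      + step_weight t * \<eta> t / 2 * ((norm (y t s - iterate (t - 1)))\<^sup>2 + (norm (xs - y t s))\<^sup>2
                          - (norm (xs - iterate (t - 1)))\<^sup>2)
    \<le> potential l t (s - 1) - potential l t s"
proof -
  have s1: "s \<ge> 1" using s by simp
  have wb: "step_weight t * \<beta> t s = LL" and wg: "step_weight t * \<gamma> t s = LL / R\<^sup>2"
    using step_weight_Mt[OF t] R by (simp_all add: beta[OF t s1] gamma[OF t s1] power2_eq_square
        flip: mult.assoc)
  have feas: "nu t *v (xs - xu t) + g (xu t) \<le> 0"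
    unfolding nu_eq[OF t] by (rule linearized_feasible)
  have int_t: "int t - 1 = int (t - 1)" using t by simp
  note step = primal_dual_step[OF LL_pos R step_weight_pos[OF t] wb wg step_weight_nonneg _ _ convex_u xs_X
      y_min[OF t s, unfolded int_t] lam_max[OF t s] l feas]
  show ?thesis
  proof (cases "s = 1")
    case True
    have "step_weight (t - 1) * op_norm (nu (t - 1)) \<le> LL / R"
      using coupling[of "t - 1"] coupling_0 by (cases "t = 1") (use t in auto)
    from step[OF this, of "lam t (- 1)"] show ?thesis
      using step_weight_h[OF t s] True by (simp add: potential_def)
  next
    case False
    have "int (s - 1) = int s - 1" using s by simp
    with step[OF coupling[OF t], of "lam t (int s - 2)"] show ?thesis
      using step_weight_h[OF t s] False s by (simp add: potential_def)
  qed
qed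

lemma iterate_in_X: "iterate t \<in> X"
proof (cases "t = 0")
  case True
  then show ?thesis using iterate_0 x0_X by simp
next
  case False
  then have t: "t \<ge> 1" by simp
  show ?thesis
    unfolding iterate_avg[OF t] using t S_pos[OF t] delta y_X[OF t] sum_delta[OF t]
    by (intro weighted_jensen(1)[OF convex_u]) auto
qed

text \<open>The descent of the potential is summed over the inner steps and passed to the phase average by
  Jensen's inequality, for the gap together with the two squared distances. The weights are
  chosen such that \<open>t * \<eta> t / 2 = LL\<close>, so the distances to \<open>xs\<close> telescope over the phases.\<close>

lemma phase_bound:
  assumes t: "t \<ge> 1" and l: "0 \<le> l"
  shows "real t * ((lagr l (xu t) + lagr_grad l (xu t) \<bullet> (iterate t - xu t)) + u (iterate t) - F_opt)
      + LL * ((norm (iterate t - iterate (t - 1)))\<^sup>2 + (norm (iterate t - xs))\<^sup>2 - (norm (iterate (t - 1) - xs))\<^sup>2)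
    \<le> potential l t 0 - potential l (t + 1) 0"
proof -
  define a where "a = iterate (t - 1)"
  define lin where "lin v = p t \<bullet> (v - xs) + l \<bullet> (nu t *v (v - xu t) + g (xu t)) - u xs
      - \<eta> t / 2 * (norm (a - xs))\<^sup>2" for v
  define \<Phi> where "\<Phi> v = u v + lin v + (\<eta> t / 2 * (norm (v - a))\<^sup>2 + \<eta> t / 2 * (norm (v - xs))\<^sup>2)" for v
  have eta_t: "\<eta> t = 2 * LL / real t"
    unfolding eta[OF t] by (subst tau) (simp_all add: mult.commute)
  have eta_nonneg: "0 \<le> \<eta> t / 2" using LL_pos by (simp add: eta_t)
  have "convex_on X lin"
    unfolding lin_def using convex_X
    by (intro convex_onI)
      (simp_all add: inner_simps matrix_vector_mult_diff_distrib matrix_vector_right_distrib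
        matrix_vector_mult_scaleR field_simps)
  then have "convex_on X \<Phi>"
    unfolding \<Phi>_def using eta_nonneg
    by (intro convex_on_add convex_u convex_on_cmul convex_on_norm_sq convex_X)
  then have "(\<Sum>s=1..S t. \<delta> t s) * \<Phi> (iterate t) \<le> (\<Sum>s=1..S t. \<delta> t s * \<Phi> (y t s))"
    unfolding iterate_avg[OF t] using t S_pos[OF t] delta y_X[OF t] sum_delta[OF t]
    by (intro weighted_jensen(2)) auto
  then have "real (S t) * \<Phi> (iterate t) \<le> (\<Sum>s=1..S t. \<Phi> (y t s))"
    using delta t by (simp add: sum_delta[OF t])
  then have "step_weight t * (real (S t) * \<Phi> (iterate t)) \<le> step_weight t * (\<Sum>s=1..S t. \<Phi> (y t s))"
    using step_weight_nonneg by (rule mult_left_mono)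
  also have "\<dots> = (\<Sum>s=1..S t. step_weight t * \<Phi> (y t s))"
    by (rule sum_distrib_left)
  also have "\<dots> \<le> (\<Sum>s=1..S t. potential l t (s - 1) - potential l t s)"
  proof (rule sum_mono)
    fix s assume s: "s \<in> {1..S t}"
    have "step_weight t * \<Phi> (y t s) =
        step_weight t * (u (y t s) - u xs + p t \<bullet> (y t s - xs) + l \<bullet> (nu t *v (y t s - xu t) + g (xu t)))
      + step_weight t * \<eta> t / 2 * ((norm (y t s - iterate (t - 1)))\<^sup>2 + (norm (xs - y t s))\<^sup>2
                          - (norm (xs - iterate (t - 1)))\<^sup>2)"
      by (simp add: \<Phi>_def lin_def a_def norm_minus_commute[of xs] field_simps)
    then show "step_weight t * \<Phi> (y t s) \<le> potential l t (s - 1) - potential l t s"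
      using inner_step[OF t s l] by simp
  qed
  also have "\<dots> = potential l t 0 - potential l t (S t)"
    using sum_telescope''[of 0 "S t" "\<lambda>s. - potential l t s"] by simp
  also have "\<dots> = potential l t 0 - potential l (t + 1) 0"
    using potential_next[OF t] by simp
  finally have A: "real t * \<Phi> (iterate t) \<le> potential l t 0 - potential l (t + 1) 0"
    using S_pos[OF t] by (simp add: step_weight_def)
  have "f (xu t) + gradf (xu t) \<bullet> (xs - xu t) \<le> f xs"
    by (rule convex_gradient_inequality[OF convex_f deriv_f])
  then have "(lagr l (xu t) + lagr_grad l (xu t) \<bullet> (iterate t - xu t)) + u (iterate t) - F_opt
      \<le> u (iterate t) + lin (iterate t) + \<eta> t / 2 * (norm (a - xs))\<^sup>2"
    by (simp add: lagr_grad_inner lin_def lagr_def p_eq[OF t] nu_eq[OF t] inner_simps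
        matrix_vector_mult_diff_distrib)
  then have "real t * ((lagr l (xu t) + lagr_grad l (xu t) \<bullet> (iterate t - xu t)) + u (iterate t) - F_opt)
      \<le> real t * (u (iterate t) + lin (iterate t) + \<eta> t / 2 * (norm (a - xs))\<^sup>2)"
    by (rule mult_left_mono) simp
  moreover have "real t * \<Phi> (iterate t) = real t * (u (iterate t) + lin (iterate t) + \<eta> t / 2 * (norm (a - xs))\<^sup>2)
      + LL * ((norm (iterate t - a))\<^sup>2 + (norm (iterate t - xs))\<^sup>2 - (norm (a - xs))\<^sup>2)"
    using t by (simp add: \<Phi>_def eta_t field_simps)
  ultimately show ?thesis
    using A by (simp add: a_def)
qed

section \<open>The ergodic bound and its consequences\<close>

lemma sum_omega: "(\<Sum>t=1..N. \<omega> t) = real N * (real N + 1) / 2"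
  by (induction N) (simp_all add: omega field_simps)

lemma sum_omega_pos: "N \<ge> 1 \<Longrightarrow> 0 < (\<Sum>t=1..N. \<omega> t)"
  by (simp only: sum_omega) simp

lemma ergodic_avg_X: assumes "N \<ge> 1" shows "ergodic_avg \<omega> x N \<in> X"
  unfolding ergodic_avg_def using iterate_in_X sum_omega_pos[OF assms]
  by (intro weighted_jensen(1)[OF convex_u]) (simp_all add: omega)

text \<open>The squared displacements of \<open>phase_bound\<close>, which help, cancel those of
  \<open>accelerated_linearization_bound\<close>, which hurt. The sum of the initial distance terms is
  \<open>LL + LL / 2\<close> times the squared distance: \<open>LL\<close> from the phase centres, \<open>LL / 2\<close> from the
  inner iterates.\<close>

lemma ergodic_bound:
  assumes l: "l \<in> multiplier_set ls c" and N: "N \<ge> 1"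
  defines "xb \<equiv> ergodic_avg \<omega> x N"
  shows "real N * (real N + 1) / 2 * (lagr l xb + u xb - F_opt) + LL * (norm (iterate N - xs))\<^sup>2
    \<le> LL / 2 * (3 * (norm (x0 - xs))\<^sup>2 + (norm l)\<^sup>2 / R\<^sup>2)"
proof -
  have l0: "0 \<le> l" using l by (rule multiplier_nonneg)
  define lin where "lin a v = lagr l a + lagr_grad l a \<bullet> (v - a)" for a v
  have "convex_on X (\<lambda>v. lin xb v - F_opt)"
    unfolding lin_def using convex_X
    by (intro convex_onI) (simp_all add: inner_simps algebra_simps)
  then have "convex_on X (\<lambda>v. (lin xb v - F_opt) + u v)"
    by (intro convex_on_add convex_u)
  then have "(\<Sum>t=1..N. \<omega> t) * ((lin xb xb - F_opt) + u xb)
      \<le> (\<Sum>t=1..N. \<omega> t * ((lin xb (iterate t) - F_opt) + u (iterate t)))"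
    unfolding xb_def ergodic_avg_def using iterate_in_X sum_omega_pos[OF N]
    by (intro weighted_jensen(2)) (simp_all add: omega)
  then have jensen: "real N * (real N + 1) / 2 * (lagr l xb + u xb - F_opt)
      \<le> (\<Sum>t=1..N. real t * (lin xb (iterate t) + u (iterate t) - F_opt))"
    unfolding sum_omega by (simp add: omega lin_def algebra_simps)
  have outer: "(\<Sum>t=1..N. real t * (lin xb (iterate t) - lin (xu t) (iterate t)))
      \<le> LL * (\<Sum>t=1..N. (norm (iterate t - iterate (t - 1)))\<^sup>2)"
    unfolding lin_def
    by (rule accelerated_linearization_bound[OF convex_lagr[OF l0] deriv_lagr LL_lipschitz[OF l]
          LL_pos momentum averaging])
  have "(\<Sum>t=1..N. real t * (lin (xu t) (iterate t) + u (iterate t) - F_opt)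
      + LL * ((norm (iterate t - iterate (t - 1)))\<^sup>2 + (norm (iterate t - xs))\<^sup>2 - (norm (iterate (t - 1) - xs))\<^sup>2))
    \<le> (\<Sum>t=1..N. potential l t 0 - potential l (t + 1) 0)"
    unfolding lin_def by (intro sum_mono phase_bound[OF _ l0]) simp
  also have "\<dots> = potential l 1 0 - potential l (N + 1) 0"
    by (induction N) simp_all
  also have "\<dots> \<le> potential l 1 0" using potential_nonneg by simp
  finally have inner: "(\<Sum>t=1..N. real t * (lin (xu t) (iterate t) + u (iterate t) - F_opt))
      + LL * (\<Sum>t=1..N. (norm (iterate t - iterate (t - 1)))\<^sup>2)
      + LL * (\<Sum>t=1..N. (norm (iterate t - xs))\<^sup>2 - (norm (iterate (t - 1) - xs))\<^sup>2) \<le> potential l 1 0"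
    by (simp add: sum.distrib sum_distrib_left distrib_left add_diff_eq[symmetric] add.assoc)
  have "(\<Sum>t=1..N. (norm (iterate t - xs))\<^sup>2 - (norm (iterate (t - 1) - xs))\<^sup>2)
      = (norm (iterate N - xs))\<^sup>2 - (norm (x0 - xs))\<^sup>2"
    using sum_telescope''[of 0 N "\<lambda>t. (norm (iterate t - xs))\<^sup>2"] iterate_0 by simp
  moreover have "(\<Sum>t=1..N. real t * (lin xb (iterate t) + u (iterate t) - F_opt))
      = (\<Sum>t=1..N. real t * (lin xb (iterate t) - lin (xu t) (iterate t)))
        + (\<Sum>t=1..N. real t * (lin (xu t) (iterate t) + u (iterate t) - F_opt))"
    unfolding sum.distrib[symmetric] by (intro sum.cong) (simp_all add: algebra_simps)
  ultimately have "real N * (real N + 1) / 2 * (lagr l xb + u xb - F_opt) + LL * (norm (iterate N - xs))\<^sup>2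
      \<le> potential l 1 0 + LL * (norm (x0 - xs))\<^sup>2"
    using jensen outer inner by (simp add: right_diff_distrib)
  then show ?thesis
    unfolding potential_init by (simp add: field_simps)
qed

definition rate_const :: real where "rate_const = 3 * (norm (x0 - xs))\<^sup>2 + d\<^sup>2 / R\<^sup>2"

lemma multiplier_norm_le: "l \<in> multiplier_set ls c \<Longrightarrow> norm l \<le> d"
  using c by (auto simp: multiplier_set_def d_def intro: order_trans[OF norm_triangle_ineq])

lemma rate_const_pos: "0 < rate_const"
proof -
  have "0 < d" using c by (simp add: d_def add_nonneg_pos)
  then have "0 < d\<^sup>2 / R\<^sup>2" using R by simp
  then show ?thesis by (simp add: rate_const_def add_nonneg_pos)
qed

lemma ls_multiplier: "ls \<in> multiplier_set ls c"
  using c by (auto simp: multiplier_set_def intro!: exI[of _ 0])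

lemma ergodic_bound_uniform:
  assumes l: "l \<in> multiplier_set ls c" and N: "N \<ge> 1"
  defines "xb \<equiv> ergodic_avg \<omega> x N"
  shows "real N * (real N + 1) / 2 * (lagr l xb + u xb - F_opt) + LL * (norm (iterate N - xs))\<^sup>2 \<le> LL / 2 * rate_const"
proof -
  have "(norm l)\<^sup>2 / R\<^sup>2 \<le> d\<^sup>2 / R\<^sup>2"
    using multiplier_norm_le[OF l] by (intro divide_right_mono power_mono) auto
  then have "LL / 2 * (3 * (norm (x0 - xs))\<^sup>2 + (norm l)\<^sup>2 / R\<^sup>2) \<le> LL / 2 * rate_const"
    using LL_pos unfolding rate_const_def by (intro mult_left_mono) auto
  with ergodic_bound[OF l N] show ?thesis unfolding xb_def by linarith
qed

lemma lagrangian_gap: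
  assumes l: "l \<in> multiplier_set ls c" and N: "N \<ge> 1"
  defines "xb \<equiv> ergodic_avg \<omega> x N"
  shows "lagr l xb + u xb - F_opt \<le> LL / (real N * (real N + 1)) * rate_const"
proof -
  have "0 \<le> LL * (norm (iterate N - xs))\<^sup>2" using LL_pos by simp
  then have "real N * (real N + 1) / 2 * (lagr l xb + u xb - F_opt) \<le> LL / 2 * rate_const"
    using ergodic_bound_uniform[OF l N] unfolding xb_def by linarith
  then have "real N * (real N + 1) * (lagr l xb + u xb - F_opt) \<le> LL * rate_const" by simp
  moreover have "real N * (real N + 1) > 0" using N by simp
  ultimately show ?thesis by (simp add: pos_le_divide_eq mult.commute)
qed

lemma pos_part_inner: "pos_part v \<bullet> v = (norm (pos_part v))\<^sup>2"
  unfolding power2_norm_eq_inner inner_vec_def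
  by (intro sum.cong) (auto simp: pos_part_def max_def)

text \<open>The multiplier \<open>0\<close> gives the first bound. For the second, the multiplier \<open>ls + l\<close> with \<open>l\<close> of norm \<open>c\<close>
  along the violation makes \<open>l \<bullet> g xb\<close> equal to \<open>c\<close> times its norm, and the rest of the
  gap is nonnegative by \<open>lagr_kkt_lower_bound\<close>.\<close>

lemma rate:
  assumes N: "N \<ge> 1"
  defines "xb \<equiv> ergodic_avg \<omega> x N"
  shows "f xb + u xb - F_opt \<le> LL / (real N * (real N + 1)) * rate_const"
    and "c * norm (pos_part (g xb)) \<le> LL / (real N * (real N + 1)) * rate_const"
proof -
  have "0 \<in> multiplier_set ls c" by (simp add: multiplier_set_def)
  from lagrangian_gap[OF this N] show "f xb + u xb - F_opt \<le> LL / (real N * (real N + 1)) * rate_const"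
    by (simp add: lagr_def xb_def)
  define v where "v = pos_part (g xb)"
  show "c * norm (pos_part (g xb)) \<le> LL / (real N * (real N + 1)) * rate_const"
  proof (cases "v = 0")
    case True
    then show ?thesis using LL_pos rate_const_pos by (simp add: v_def)
  next
    case False
    define l where "l = (c / norm v) *\<^sub>R v"
    have "0 \<le> v" by (simp add: v_def pos_part_def less_eq_vec_def)
    then have "0 \<le> l" using c by (simp add: l_def less_eq_vec_def)
    moreover have "norm l \<le> c" using False c by (simp add: l_def)
    ultimately have "ls + l \<in> multiplier_set ls c" by (auto simp: multiplier_set_def)
    from lagrangian_gap[OF this N]
    have "lagr ls xb + l \<bullet> g xb + u xb - F_opt \<le> LL / (real N * (real N + 1)) * rate_const"
      by (simp add: xb_def lagr_def inner_add_left add.assoc)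
    moreover have "F_opt \<le> lagr ls xb + u xb"
      unfolding xb_def by (rule lagr_kkt_lower_bound[OF ergodic_avg_X[OF N]])
    moreover have "l \<bullet> g xb = c * norm v"
      using False pos_part_inner[of "g xb"] by (simp add: l_def v_def power2_eq_square)
    ultimately show ?thesis by (simp add: v_def)
  qed
qed

text \<open>With the multiplier \<open>ls\<close> the gap is nonnegative, which leaves the distance of the last
  iterate in \<open>ergodic_bound_uniform\<close>.\<close>

lemma iterate_bounded: "norm (iterate t - xs) \<le> sqrt rate_const"
proof (cases "t = 0")
  case True
  have "(norm (x0 - xs))\<^sup>2 \<le> rate_const" by (simp add: rate_const_def)
  then show ?thesis using True iterate_0 by (simp add: real_le_rsqrt)
next
  case False
  then have t: "t \<ge> 1" by simp
  have "0 \<le> real t * (real t + 1) / 2 * (lagr ls (ergodic_avg \<omega> x t) + u (ergodic_avg \<omega> x t) - F_opt)"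
    using lagr_kkt_lower_bound[OF ergodic_avg_X[OF t]] by simp
  then have "LL * (norm (iterate t - xs))\<^sup>2 \<le> LL * (rate_const / 2)"
    using ergodic_bound_uniform[OF ls_multiplier t] by simp
  then have "(norm (iterate t - xs))\<^sup>2 \<le> rate_const / 2" using LL_pos by simp
  then show ?thesis using rate_const_pos by (intro real_le_rsqrt) simp
qed

text \<open>The extrapolated point leaves the ball of the iterates by at most one displacement, hence the
  factor \<open>3\<close>; the averaged points are convex combinations of such points and stay in the larger ball.\<close>

lemma xt_bounded: "norm (xt (t + 1) - xs) \<le> 3 * sqrt rate_const"
proof -
  have "real (t + 1) *\<^sub>R (xt (t + 1) - xs)
      = real (t + 1) *\<^sub>R (iterate t - xs) + real t *\<^sub>R ((iterate t - xs) - (iterate (t - 1) - xs))"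
    using momentum[of t] by (simp add: scaleR_diff_right)
  then have "real (t + 1) * norm (xt (t + 1) - xs)
      = norm (real (t + 1) *\<^sub>R (iterate t - xs) + real t *\<^sub>R ((iterate t - xs) - (iterate (t - 1) - xs)))"
    by (metis norm_scaleR abs_of_nat)
  also have "\<dots> \<le> real (t + 1) * norm (iterate t - xs) + real t * norm ((iterate t - xs) - (iterate (t - 1) - xs))"
    by (metis norm_triangle_ineq norm_scaleR abs_of_nat)
  also have "\<dots> \<le> real (t + 1) * norm (iterate t - xs) + real t * (norm (iterate t - xs) + norm (iterate (t - 1) - xs))"
    by (intro add_left_mono mult_left_mono norm_triangle_ineq4) simp
  also have "\<dots> \<le> real (t + 1) * sqrt rate_const + real t * (sqrt rate_const + sqrt rate_const)"
    by (intro add_mono mult_left_mono iterate_bounded) auto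
  also have "\<dots> \<le> real (t + 1) * (3 * sqrt rate_const)"
    using rate_const_pos by (simp add: algebra_simps)
  finally show ?thesis by simp
qed

lemma xu_bounded: "norm (xu t - xs) \<le> 3 * sqrt rate_const"
proof (induction t)
  case 0
  have "0 < sqrt rate_const" using rate_const_pos by simp
  moreover have "norm (xu 0 - xs) \<le> sqrt rate_const" using iterate_bounded[of 0] xu_0 iterate_0 by simp
  ultimately show ?case by linarith
next
  case (Suc t)
  have "(1 + real t / 2) *\<^sub>R (xu (t + 1) - xs) = (real t / 2) *\<^sub>R (xu t - xs) + (xt (t + 1) - xs)"
    using averaging[of t] by (simp add: algebra_simps)
  then have "(1 + real t / 2) * norm (xu (t + 1) - xs) = norm ((real t / 2) *\<^sub>R (xu t - xs) + (xt (t + 1) - xs))"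
    by (metis norm_scaleR abs_of_nonneg add_nonneg_nonneg divide_nonneg_nonneg of_nat_0_le_iff zero_le_numeral zero_le_one)
  also have "\<dots> \<le> real t / 2 * norm (xu t - xs) + norm (xt (t + 1) - xs)"
    by (rule order_trans[OF norm_triangle_ineq]) simp
  also have "\<dots> \<le> real t / 2 * (3 * sqrt rate_const) + 3 * sqrt rate_const"
    by (intro add_mono mult_left_mono Suc.IH xt_bounded) simp
  also have "\<dots> = (1 + real t / 2) * (3 * sqrt rate_const)" by (simp add: algebra_simps)
  finally show ?case by (simp add: add_nonneg_pos mult_le_cancel_left_pos add_pos_nonneg)
qed

lemma sum_S_le:
  assumes M_le: "\<And>t. t \<ge> 1 \<Longrightarrow> M t \<le> Mbar"
  shows "real (\<Sum>t=1..N. S t) \<le> Mbar * \<Delta> * (real N * (real N + 1) / 2) + real N"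
proof (induction N)
  case (Suc N)
  have "M (Suc N) * (\<Delta> * real (Suc N)) \<le> Mbar * (\<Delta> * real (Suc N))"
    using M_le[of "Suc N"] R LL_pos by (intro mult_right_mono) (auto simp: Delta)
  then have "real (S (Suc N)) \<le> Mbar * \<Delta> * real (Suc N) + 1"
    using S_le[of "Suc N"] by (simp add: mult.assoc)
  moreover have "Mbar * \<Delta> * (real (Suc N) * (real (Suc N) + 1) / 2)
      = Mbar * \<Delta> * (real N * (real N + 1) / 2) + Mbar * \<Delta> * real (Suc N)"
    by (simp add: field_simps)
  moreover have "real (\<Sum>t=1..Suc N. S t) = real (\<Sum>t=1..N. S t) + real (S (Suc N))"
    and "real (Suc N) = real N + 1"
    by simp_all
  ultimately show ?case using Suc.IH by linarith
qed simp

text \<open>With \<open>q = N\<epsilon> - 1\<close>, the number of phases is \<open>\<lceil>q\<rceil>\<close>, and \<open>q\<^sup>2\<close> is \<open>LL * rate_const / \<epsilon>\<close>. The inner steps number at most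
  \<open>Mbar * \<Delta> * N * (N + 1) / 2 + N\<close> and cost at most two multiplications each; the estimate \<open>N * (N + 1) \<le> 4 * q\<^sup>2 + 12\<close> separates the term
  in \<open>1 / \<epsilon>\<close> from the constant one: the factor \<open>12\<close> is \<open>4\<close> times the coefficient \<open>3\<close> in \<open>rate_const\<close>.\<close>

lemma complexity:
  assumes eps: "\<epsilon> > 0"
    and Mbar: "Mbar \<ge> 0" and M_le: "\<And>t. t \<ge> 1 \<Longrightarrow> M t \<le> Mbar"
    and mv: "\<And>t s. t \<ge> 1 \<Longrightarrow> s \<in> {1..S t} \<Longrightarrow> mv t s < 3"
  defines "N\<epsilon> \<equiv> sqrt (LL / \<epsilon>) * sqrt rate_const + 1"
  shows "\<exists>N\<ge>1. eps_optimal X (\<lambda>z. f z + u z) g F_opt \<epsilon> (\<epsilon> / c) (ergodic_avg \<omega> x N) \<and>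
    real N \<le> N\<epsilon> \<and>
    real (\<Sum>t=1..N. \<Sum>s=1..S t. mv t s)
      \<le> 12 * (N\<epsilon> + Mbar * R / LL + Mbar / \<epsilon> * ((norm (x0 - xs))\<^sup>2 * R + d\<^sup>2 / R))"
proof -
  define q where "q = sqrt (LL / \<epsilon>) * sqrt rate_const"
  have q: "q > 0" using LL_pos rate_const_pos eps by (simp add: q_def)
  have q2: "q\<^sup>2 = LL * rate_const / \<epsilon>"
    using LL_pos rate_const_pos eps by (simp add: q_def power_mult_distrib)
  have N\<epsilon>: "N\<epsilon> = q + 1" by (simp add: q_def N\<epsilon>_def)
  define N where "N = nat \<lceil>q\<rceil>"
  have N_ge: "q \<le> real N" and N_le: "real N \<le> q + 1" using q unfolding N_def by linarith+
  have N1: "N \<ge> 1" using q N_ge by (cases N) auto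
  have "LL * rate_const \<le> \<epsilon> * (real N * (real N + 1))"
  proof -
    have "LL * rate_const = \<epsilon> * q\<^sup>2" using eps by (simp add: q2)
    also have "q\<^sup>2 \<le> real N * (real N + 1)"
      using N_ge q unfolding power2_eq_square by (intro mult_mono) auto
    finally show ?thesis using eps by simp
  qed
  then have "LL / (real N * (real N + 1)) * rate_const \<le> \<epsilon>"
    using N1 by (simp add: pos_divide_le_eq)
  then have "eps_optimal X (\<lambda>z. f z + u z) g F_opt \<epsilon> (\<epsilon> / c) (ergodic_avg \<omega> x N)"
    using rate[OF N1] ergodic_avg_X[OF N1] c
    by (auto simp: eps_optimal_def pos_le_divide_eq mult.commute)
  moreover have "real (\<Sum>t=1..N. \<Sum>s=1..S t. mv t s)
      \<le> 12 * (N\<epsilon> + Mbar * R / LL + Mbar / \<epsilon> * ((norm (x0 - xs))\<^sup>2 * R + d\<^sup>2 / R))"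
  proof -
    have "(\<Sum>t=1..N. \<Sum>s=1..S t. mv t s) \<le> (\<Sum>t=1..N. \<Sum>s=1..S t. 2)"
      using mv by (intro sum_mono) (auto simp: less_Suc_eq_le numeral_3_eq_3 numeral_2_eq_2)
    then have "(\<Sum>t=1..N. \<Sum>s=1..S t. mv t s) \<le> 2 * (\<Sum>t=1..N. S t)"
      by (simp add: sum_distrib_left mult.commute)
    then have "real (\<Sum>t=1..N. \<Sum>s=1..S t. mv t s) \<le> real (2 * (\<Sum>t=1..N. S t))"
      by (rule of_nat_mono)
    also have "\<dots> \<le> Mbar * \<Delta> * (real N * (real N + 1)) + 2 * real N"
      using sum_S_le[OF M_le, of N] by simp
    also have "\<dots> \<le> Mbar * \<Delta> * (4 * q\<^sup>2 + 12) + 12 * N\<epsilon>"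
    proof (intro add_mono mult_left_mono)
      have "real N * (real N + 1) \<le> (q + 1) * (q + 2)"
        using N_le q by (intro mult_mono) auto
      also have "\<dots> \<le> 4 * q\<^sup>2 + 12"
        using zero_le_power2[of "q - 1/2"] by (simp add: power2_eq_square algebra_simps)
      finally show "real N * (real N + 1) \<le> 4 * q\<^sup>2 + 12" .
      show "2 * real N \<le> 12 * N\<epsilon>" using N_le q N\<epsilon> by linarith
      show "0 \<le> Mbar * \<Delta>" using Mbar R LL_pos by (simp add: Delta)
    qed
    also have "Mbar * \<Delta> * (4 * q\<^sup>2 + 12)
        = 12 * (Mbar * R / LL) + Mbar / \<epsilon> * (12 * ((norm (x0 - xs))\<^sup>2 * R) + 4 * (d\<^sup>2 / R))"
      using LL_pos R eps unfolding q2 rate_const_def Delta by (simp add: field_simps power2_eq_square)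
    also have "\<dots> \<le> 12 * (Mbar * R / LL) + Mbar / \<epsilon> * (12 * ((norm (x0 - xs))\<^sup>2 * R) + 12 * (d\<^sup>2 / R))"
      using Mbar eps R by (intro add_left_mono mult_left_mono add_mono mult_right_mono) auto
    finally show ?thesis by (simp add: algebra_simps)
  qed
  moreover have "real N \<le> N\<epsilon>" using N_le N\<epsilon> by simp
  ultimately show ?thesis using N1 by blast
qed

lemma M_le_op_norm_bound:
  assumes "\<And>z. z \<in> cball xs (3 * sqrt rate_const) \<Longrightarrow> max 1 (op_norm (J z)) \<le> Mbar" and t: "t \<ge> 1"
  shows "M t \<le> Mbar"
proof -
  have "xu t \<in> cball xs (3 * sqrt rate_const)" using xu_bounded by (simp add: dist_norm norm_minus_commute)
  from assms(1)[OF this] show ?thesis by (simp add: M[OF t] nu_eq[OF t])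
qed

end

section \<open>The convergence theorem\<close>

theorem theorem5:
  fixes X D :: "(real ^ 'n) set"
    and f u :: "real ^ 'n \<Rightarrow> real" and gradf :: "real ^ 'n \<Rightarrow> real ^ 'n"
    and g :: "real ^ 'n \<Rightarrow> real ^ 'm" and J :: "real ^ 'n \<Rightarrow> real ^ 'n ^ 'm"
    and xs x0 :: "real ^ 'n" and ls :: "real ^ 'm"
    and L :: "real ^ 'm \<Rightarrow> real" and c R LL d \<Delta> :: real
    and \<tau> \<eta> \<omega> \<theta> M Mt :: "nat \<Rightarrow> real" and S :: "nat \<Rightarrow> nat"
    and \<rho> \<beta> \<gamma> \<delta> :: "nat \<Rightarrow> nat \<Rightarrow> real"
    and x :: "int \<Rightarrow> real ^ 'n" and xt xu p :: "nat \<Rightarrow> real ^ 'n"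
    and nu :: "nat \<Rightarrow> real ^ 'n ^ 'm"
    and h y :: "nat \<Rightarrow> nat \<Rightarrow> real ^ 'n" and lam :: "nat \<Rightarrow> int \<Rightarrow> real ^ 'm"
    and mv :: "nat \<Rightarrow> nat \<Rightarrow> nat"
  assumes problem: "smooth_convex_problem X f gradf g J D u"
    and kkt: "kkt_pair X f gradf g J D u xs ls"
    and L_lipschitz: "\<And>l. 0 \<le> l \<Longrightarrow> (L l)-lipschitz_on UNIV (lagrangian_grad gradf J l)"
    and L_bdd: "bdd_above (L ` multiplier_set ls c)"
    and LL_def: "LL = (SUP l\<in>multiplier_set ls c. L l)"
    and LL_pos: "LL > 0"
    and c: "c \<ge> 1" and R: "R > 0"
    and d_def: "d = norm ls + c"
    and run: "acgd_s_run X gradf g J u \<tau> \<eta> \<theta> S \<rho> \<beta> \<gamma> \<delta> x0 x xt xu p nu h y lam"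
    and tau: "\<And>t. t \<ge> 1 \<Longrightarrow> \<tau> t = (real t - 1) / 2"
    and eta: "\<And>t. t \<ge> 1 \<Longrightarrow> \<eta> t = LL / \<tau> (t + 1)"
    and omega: "\<And>t. t \<ge> 1 \<Longrightarrow> \<omega> t = real t"
    and theta: "\<And>t. t \<ge> 1 \<Longrightarrow> \<theta> (t + 1) = \<omega> t / \<omega> (t + 1)"
    and M: "\<And>t. t \<ge> 1 \<Longrightarrow> M t = (if op_norm (nu t) > 0 then op_norm (nu t) else 1)"
    and Delta: "\<Delta> = R / LL"
    and S: "\<And>t. t \<ge> 1 \<Longrightarrow> S t = nat \<lceil>M t * \<Delta> * real t\<rceil>"
    and Mt: "\<And>t. t \<ge> 1 \<Longrightarrow> Mt t = real (S t) / (\<Delta> * real t)"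
    and rho: "\<And>t s. t \<ge> 1 \<Longrightarrow> s \<ge> 1 \<Longrightarrow>
               \<rho> t s = (if s = 1 \<and> t \<ge> 2 then Mt t / Mt (t - 1) else 1)"
    and beta: "\<And>t s. t \<ge> 1 \<Longrightarrow> s \<ge> 1 \<Longrightarrow> \<beta> t s = Mt t * R"
    and gamma: "\<And>t s. t \<ge> 1 \<Longrightarrow> s \<ge> 1 \<Longrightarrow> \<gamma> t s = Mt t / R"
    and delta: "\<And>t s. t \<ge> 1 \<Longrightarrow> s \<ge> 1 \<Longrightarrow> \<delta> t s = 1"
    \<comment> \<open>number of matrix-vector multiplications in inner iteration \<open>s\<close> of phase \<open>t\<close>\<close>
    and mv: "\<And>t s. t \<ge> 1 \<Longrightarrow> s \<in> {1..S t} \<Longrightarrow> mv t s < 3"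
  shows "(\<forall>N\<ge>1.
            max (f (ergodic_avg \<omega> x N) + u (ergodic_avg \<omega> x N) - (f xs + u xs))
                (c * norm (pos_part (g (ergodic_avg \<omega> x N))))
            \<le> LL / (real N * (real N + 1)) * (3 * (norm (x0 - xs))\<^sup>2 + d\<^sup>2 / R\<^sup>2)) \<and>
         (\<exists>B. bounded B \<and> xs \<in> interior B \<and>
            (\<forall>Mbar. (\<forall>z\<in>B. max 1 (op_norm (J z)) \<le> Mbar) \<longrightarrow>
               (\<forall>t\<ge>1. M t \<le> Mbar) \<and>
               (\<forall>\<epsilon>>0. \<not> eps_optimal X (\<lambda>z. f z + u z) g (f xs + u xs) \<epsilon> (\<epsilon> / c) x0 \<longrightarrow>
                  (let N\<epsilon> = sqrt (LL / \<epsilon>) * sqrt (3 * (norm (x0 - xs))\<^sup>2 + d\<^sup>2 / R\<^sup>2) + 1 in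
                   \<exists>N\<ge>1. eps_optimal X (\<lambda>z. f z + u z) g (f xs + u xs) \<epsilon> (\<epsilon> / c) (ergodic_avg \<omega> x N) \<and>
                     real N \<le> N\<epsilon> \<and>
                     real (\<Sum>t=1..N. \<Sum>s=1..S t. mv t s)
                       \<le> 12 * (N\<epsilon> + Mbar * R / LL
                               + Mbar / \<epsilon> * ((norm (x0 - xs))\<^sup>2 * R + d\<^sup>2 / R))))))"
proof -
  interpret A: acgd_s X D f u gradf g J xs x0 ls L c R LL d \<Delta> \<tau> \<eta> \<omega> \<theta> M Mt S \<rho> \<beta> \<gamma> \<delta> x xt xu p nu h y lam
    by (rule acgd_s.intro) fact+
  have ball: "xs \<in> interior (cball xs (3 * sqrt A.rate_const))"
    using A.rate_const_pos by simp
  have "M t \<le> Mbar" and "0 \<le> Mbar"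
    if "\<forall>z\<in>cball xs (3 * sqrt A.rate_const). max 1 (op_norm (J z)) \<le> Mbar" and "t \<ge> 1" for Mbar t
  proof -
    show "M t \<le> Mbar" using that by (intro A.M_le_op_norm_bound) auto
    with A.M_pos[OF \<open>t \<ge> 1\<close>] show "0 \<le> Mbar" by linarith
  qed
  note Mbar = this(1) this(2)[OF _ order_refl]
  show ?thesis
  proof (intro conjI exI[of _ "cball xs (3 * sqrt A.rate_const)"] ball bounded_cball allI impI)
    fix N :: nat assume "N \<ge> 1"
    from A.rate[OF this] show "max (f (ergodic_avg \<omega> x N) + u (ergodic_avg \<omega> x N) - (f xs + u xs))
        (c * norm (pos_part (g (ergodic_avg \<omega> x N))))
      \<le> LL / (real N * (real N + 1)) * (3 * (norm (x0 - xs))\<^sup>2 + d\<^sup>2 / R\<^sup>2)"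
      by (simp add: A.rate_const_def)
  next
    fix Mbar \<epsilon> :: real
    assume "\<forall>z\<in>cball xs (3 * sqrt A.rate_const). max 1 (op_norm (J z)) \<le> Mbar" and "\<epsilon> > 0"
    then show "let N\<epsilon> = sqrt (LL / \<epsilon>) * sqrt (3 * (norm (x0 - xs))\<^sup>2 + d\<^sup>2 / R\<^sup>2) + 1 in
        \<exists>N\<ge>1. eps_optimal X (\<lambda>z. f z + u z) g (f xs + u xs) \<epsilon> (\<epsilon> / c) (ergodic_avg \<omega> x N) \<and>
          real N \<le> N\<epsilon> \<and>
          real (\<Sum>t=1..N. \<Sum>s=1..S t. mv t s)
            \<le> 12 * (N\<epsilon> + Mbar * R / LL + Mbar / \<epsilon> * ((norm (x0 - xs))\<^sup>2 * R + d\<^sup>2 / R))"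
      unfolding Let_def A.rate_const_def[symmetric]
      by (intro A.complexity Mbar mv)
  qed (use Mbar in blast)
qed

end
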